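(* Let $\mathcal{G}=\langle a,b,c\rangle\le \mathrm{Aut}(\{0,1\}^* )$ be the group generated by $a=(1,1)\sigma$, $b=(a,c)$, $c=(b,1)$ (the iterated monodromy group $\mathrm{IMG}(z^2+\mathrm{i})$), acting on the boundary $X^\omega=\{0,1\}^{\omega}$ of the tree. For real $y,z,\lambda$ let $\widetilde M(y,z,\lambda)=\pi_a+y\pi_b+z\pi_c-\lambda$ be the corresponding operator on $L_2(X^\omega)$, and for $n\ge0$ let $\widetilde M_n(y,z,\lambda)$ be its restriction to the finite-dimensional invariant subspace $\mathcal{H}_n$. Let $\mathrm{sp}(\widetilde M)\subset\mathbb{R}^3$ (resp. $\mathrm{sp}_n\subset\mathbb{R}^3$) be the set of $(y,z,\lambda)$ at which $\widetilde M(y,z,\lambda)$ (resp. $\widetilde M_n(y,z,\lambda)$) is not invertible. Let $F$ be the rational map on $\mathbb{R}^3$ $$F(y,z,\lambda)=\left(\frac zy,\ \frac{1}{-y^2+z^2-2z\lambda+\lambda^2},\ \frac{-\lambda y^2+\lambda z^2-2z\lambda^2+\lambda^3+z-\lambda}{y(-y^2+z^2-2z\lambda+\lambda^2)}\right),$$ and put $$P=\{(y,z,\lambda): 1+y+z-\lambda=0\},\qquad Z_1=\{(y,z,\lambda):(z-\lambda-y)(z-\lambda+y)=0\},$$ $$Z_2=\{(0,z,\lambda): \bigl(1-(\lambda-z)(\lambda+z)\bigr)(1-\lambda+z)(1+\lambda-z)=0\},\qquad Z_3=Z_2\cup F^{-1}(Z_2).$$ Then $$\overline{Z_3\cup\bigcup_{i=0}^\infty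 F^{-i}(P)}\ \subset\ \mathrm{sp}(\widetilde M)=\overline{\bigcup_{n=0}^\infty \mathrm{sp}_n}\ \subset\ \overline{Z_3\cup\bigcup_{i=0}^\infty F^{-i}(P\cup Z_1)},$$ where bars denote closure in $\mathbb{R}^3$.
   Context: Let $X=\{0,1\}$; $X^*$ (finite words) is the binary rooted tree and $X^\omega$ (infinite words) its boundary. Every tree automorphism $g$ is written uniquely as $g=(g|_0,g|_1)\sigma_g$, where $\sigma_g\in\mathrm{Sym}(2)$ is the permutation of $X$ induced by $g$ and $g|_x\in\mathrm{Aut}(X^* )$ is determined by $g(xw)=\sigma_g(x)\,g|_x(w)$. Products are defined by $gh(w)=h(g(w))$. The nontrivial element of $\mathrm{Sym}(2)$ is denoted $\sigma$. $L_2(X^\omega)$ is taken with respect to the uniform Bernoulli measure on $X^\omega$ (each cylinder $vX^\omega$, $v\in X^n$, has measure $2^{-n}$), which is invariant under tree automorphisms, and $(\pi_g f)(x)=f(g^{-1}x)$. $\mathcal{H}_n\subset L_2(X^\omega)$ is the $2^n$-dimensional span of the characteristic functions of the cylinders $vX^\omega$, $v\in X^n$; it is invariant under all $\pi_g$, and $\mathcal{H}_n\subset\mathcal{H}_{n+1}$. A scalar $\lambda$ in an operator expression means $\lambda$ times the identity. The map $F$ is defined at points with $y\neq0$ that do not lie on $Z_1$; $F^{-i}(S)$ denotes the set of points at which the $i$-th iterate $F^i$ is defined and takes a value in $S$ (with $F^0$ the identity). *)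

theory Defs
  imports "HOL-Probability.Probability" "HOL-Algebra.Generated_Groups"
begin

section \<open>The binary rooted tree and its automorphisms\<close>

text \<open>
  The alphabet \<open>X = {0,1}\<close> is \<^typ>\<open>bool\<close>, with \<^const>\<open>False\<close> for 0 and \<^const>\<open>True\<close> for 1; finite words
  are lists, infinite words are streams. The tree has root \<open>[]\<close> and edges \<open>v \<rightarrow> v @ [x]\<close>.
\<close>

typedef tree_aut =
  "{g :: bool list \<Rightarrow> bool list. bij g \<and> g [] = [] \<and> (\<forall>v x. \<exists>y. g (v @ [x]) = g v @ [y])}"
  morphisms app_word Abs_tree_aut
  by (rule exI[of _ id]) auto

setup_lifting type_definition_tree_aut

lemma app_word_bij: "bij (app_word g)"
  and app_word_Nil [simp]: "app_word g [] = []"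
  and app_word_snoc: "\<exists>y. app_word g (v @ [x]) = app_word g v @ [y]"
  using app_word[of g] by auto

lemma app_word_append:
  "\<exists>u. length u = length w \<and> app_word g (v @ w) = app_word g v @ u"
proof (induction w rule: rev_induct)
  case (snoc x w)
  then obtain u where u: "length u = length w" "app_word g (v @ w) = app_word g v @ u" by blast
  obtain y where "app_word g ((v @ w) @ [x]) = app_word g (v @ w) @ [y]"
    using app_word_snoc by blast
  with u have "length (u @ [y]) = length (w @ [x]) \<and> app_word g (v @ w @ [x]) = app_word g v @ (u @ [y])"
    by simp
  then show ?case by blast
qed auto

lemma length_app_word [simp]: "length (app_word g w) = length w"
  using app_word_append[of w g "[]"] by auto

lemma take_app_word: "take n (app_word g w) = app_word g (take n w)"
proof -
  obtain u where "app_word g (take n w @ drop n w) = app_word g (take n w) @ u"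
    using app_word_append by blast
  then have *: "app_word g w = app_word g (take n w) @ u" by simp
  have l: "length (app_word g (take n w)) = min n (length w)" by simp
  show ?thesis
  proof (cases "n \<le> length w")
    case True
    then have "n = length (app_word g (take n w))" by simp
    with * show ?thesis by (metis append_eq_conv_conj)
  qed simp
qed

lift_definition tree_one :: tree_aut is "\<lambda>w. w"
  by (auto simp: bij_def)

text \<open>The product is \<open>(g h)(w) = h (g w)\<close>.\<close>

lift_definition tree_mult :: "tree_aut \<Rightarrow> tree_aut \<Rightarrow> tree_aut" is "\<lambda>g h w. h (g w)"
proof -
  fix g h :: "bool list \<Rightarrow> bool list"
  assume g: "bij g \<and> g [] = [] \<and> (\<forall>v x. \<exists>y. g (v @ [x]) = g v @ [y])"
    and h: "bij h \<and> h [] = [] \<and> (\<forall>v x. \<exists>y. h (v @ [x]) = h v @ [y])"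
  have "bij (h \<circ> g)" using g h by (intro bij_comp) auto
  moreover have "\<exists>y. h (g (v @ [x])) = h (g v) @ [y]" for v x
    using g h by metis
  ultimately show "bij (\<lambda>w. h (g w)) \<and> h (g []) = [] \<and>
      (\<forall>v x. \<exists>y. h (g (v @ [x])) = h (g v) @ [y])"
    using g h by (simp add: comp_def)
qed

definition Aut_tree :: "tree_aut monoid" where
  "Aut_tree = \<lparr>carrier = UNIV, mult = tree_mult, one = tree_one\<rparr>"

lemma tree_aut_eqI: "(\<And>w. app_word g w = app_word h w) \<Longrightarrow> g = h"
  by (metis app_word_inject ext)

lemma ex_tree_inverse: "\<exists>h. tree_mult h g = tree_one"
proof -
  let ?h = "inv_into UNIV (app_word g)"
  have gh: "app_word g (?h w) = w" and hg: "?h (app_word g w) = w" for w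
    using app_word_bij[of g] by (simp_all add: bij_def surj_f_inv_f)
  have len: "length (?h w) = length w" for w
    using length_app_word[of g "?h w"] gh by simp
  have "\<exists>y. ?h (v @ [x]) = ?h v @ [y]" for v x
  proof -
    let ?u = "?h (v @ [x])"
    have "app_word g (take (length v) ?u) = v"
      by (simp add: take_app_word[symmetric] gh)
    then have "take (length v) ?u = ?h v" by (metis hg)
    moreover have "length (drop (length v) ?u) = Suc 0" by (simp add: len)
    then obtain y where "drop (length v) ?u = [y]"
      by (metis length_0_conv length_Suc_conv)
    ultimately have "?u = ?h v @ [y]" by (metis append_take_drop_id)
    then show ?thesis ..
  qed
  moreover have "?h [] = []" using len[of "[]"] by simp
  moreover have "bij ?h" using app_word_bij by (rule bij_imp_bij_inv)
  ultimately have "app_word (Abs_tree_aut ?h) = ?h"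
    by (intro Abs_tree_aut_inverse) auto
  then have "tree_mult (Abs_tree_aut ?h) g = tree_one"
    by (intro tree_aut_eqI) (simp add: tree_mult.rep_eq tree_one.rep_eq gh)
  then show ?thesis ..
qed

lemma group_Aut_tree: "group Aut_tree"
proof (rule groupI)
  fix g assume "g \<in> carrier Aut_tree"
  show "\<exists>h\<in>carrier Aut_tree. h \<otimes>\<^bsub>Aut_tree\<^esub> g = \<one>\<^bsub>Aut_tree\<^esub>"
    using ex_tree_inverse[of g] by (simp add: Aut_tree_def)
qed (auto simp: Aut_tree_def tree_mult.rep_eq tree_one.rep_eq intro: tree_aut_eqI)

text \<open>\<open>g = (g|0, g|1) \<sigma>\<^sub>g\<close>, where \<open>g (x w) = \<sigma>\<^sub>g(x) g|x (w)\<close>.\<close>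

definition root_perm :: "tree_aut \<Rightarrow> bool \<Rightarrow> bool" where
  "root_perm g x = hd (app_word g [x])"

definition restriction_to :: "tree_aut \<Rightarrow> bool \<Rightarrow> tree_aut" where
  "restriction_to g x = (THE h. \<forall>w. app_word g (x # w) = root_perm g x # app_word h w)"

lemma restriction_toI:
  assumes "\<And>w. app_word g (x # w) = y # app_word h w"
  shows "root_perm g x = y" "restriction_to g x = h"
proof -
  show r: "root_perm g x = y" by (simp add: root_perm_def assms)
  show "restriction_to g x = h"
    unfolding restriction_to_def r
    by (rule the_equality) (auto simp: assms intro: tree_aut_eqI)
qed


section \<open>The group IMG(z^2 + i)\<close>

fun word_a :: "bool list \<Rightarrow> bool list" where
  "word_a [] = []"
| "word_a (x # w) = (\<not> x) # w"

fun word_b word_c :: "bool list \<Rightarrow> bool list" where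
  "word_b [] = []"
| "word_b (x # w) = (if x then x # word_c w else x # word_a w)"
| "word_c [] = []"
| "word_c (x # w) = (if x then x # w else x # word_b w)"

lemma word_a_invol: "word_a (word_a w) = w"
  by (cases w) auto

lemma word_bc_invol: "word_b (word_b w) = w" "word_c (word_c w) = w"
  by (induction w and w rule: word_b_word_c.induct) (auto simp: word_a_invol)

lemma word_a_snoc: "\<exists>y. word_a (v @ [x]) = word_a v @ [y]"
  by (cases v) auto

lemma word_bc_snoc: "\<exists>y. word_b (v @ [x]) = word_b v @ [y]" "\<exists>y. word_c (v @ [x]) = word_c v @ [y]"
  by (induction v and v rule: word_b_word_c.induct) (auto simp: word_a_snoc)

lift_definition gen_a :: tree_aut is word_a
  using involuntory_imp_bij[of word_a] by (simp add: word_a_snoc word_a_invol)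

lift_definition gen_b :: tree_aut is word_b
  using involuntory_imp_bij[of word_b] by (simp add: word_bc_snoc word_bc_invol)

lift_definition gen_c :: tree_aut is word_c
  using involuntory_imp_bij[of word_c] by (simp add: word_bc_snoc word_bc_invol)

lemma gen_a_wreath:
  "restriction_to gen_a False = tree_one" "restriction_to gen_a True = tree_one"
  "root_perm gen_a = Not"
proof -
  have "app_word gen_a (x # w) = (\<not> x) # app_word tree_one w" for x w
    by (simp add: gen_a.rep_eq tree_one.rep_eq)
  note R = restriction_toI[OF this]
  show "restriction_to gen_a False = tree_one" "restriction_to gen_a True = tree_one" by fact+
  show "root_perm gen_a = Not" by (rule ext) fact
qed

lemma gen_b_wreath:
  "restriction_to gen_b False = gen_a" "restriction_to gen_b True = gen_c"
  "root_perm gen_b = id"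
proof -
  have "app_word gen_b (False # w) = False # app_word gen_a w"
    "app_word gen_b (True # w) = True # app_word gen_c w" for w
    by (simp_all add: gen_a.rep_eq gen_b.rep_eq gen_c.rep_eq)
  note R = restriction_toI[OF this(1)] restriction_toI[OF this(2)]
  show "restriction_to gen_b False = gen_a" "restriction_to gen_b True = gen_c" by fact+
  show "root_perm gen_b = id"
  proof
    fix x show "root_perm gen_b x = id x" using R by (cases x) simp_all
  qed
qed

lemma gen_c_wreath:
  "restriction_to gen_c False = gen_b" "restriction_to gen_c True = tree_one"
  "root_perm gen_c = id"
proof -
  have "app_word gen_c (False # w) = False # app_word gen_b w"
    "app_word gen_c (True # w) = True # app_word tree_one w" for w
    by (simp_all add: gen_b.rep_eq gen_c.rep_eq tree_one.rep_eq)
  note R = restriction_toI[OF this(1)] restriction_toI[OF this(2)]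
  show "restriction_to gen_c False = gen_b" "restriction_to gen_c True = tree_one" by fact+
  show "root_perm gen_c = id"
  proof
    fix x show "root_perm gen_c x = id x" using R by (cases x) simp_all
  qed
qed

definition IMG_i :: "tree_aut set" where
  "IMG_i = generate Aut_tree {gen_a, gen_b, gen_c}"

lemma subgroup_IMG_i: "subgroup IMG_i Aut_tree"
  unfolding IMG_i_def
  by (rule group.generate_is_subgroup[OF group_Aut_tree]) (simp add: Aut_tree_def)

lemma gens_in_IMG_i: "gen_a \<in> IMG_i" "gen_b \<in> IMG_i" "gen_c \<in> IMG_i"
  unfolding IMG_i_def by (auto intro: generate.incl)


section \<open>The boundary and its uniform Bernoulli measure\<close>

definition cylinder :: "bool list \<Rightarrow> bool stream set" where
  "cylinder v = {x. stake (length v) x = v}"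

definition app_bdry :: "tree_aut \<Rightarrow> bool stream \<Rightarrow> bool stream" where
  "app_bdry g x = to_stream (\<lambda>n. app_word g (stake (Suc n) x) ! n)"

lemma stake_app_bdry: "stake n (app_bdry g x) = app_word g (stake n x)"
proof (rule nth_equalityI)
  fix i assume i: "i < length (stake n (app_bdry g x))"
  then have "app_word g (stake (Suc i) x) = take (Suc i) (app_word g (stake n x))"
    by (simp add: take_app_word take_stake min_def)
  with i show "stake n (app_bdry g x) ! i = app_word g (stake n x) ! i"
    by (simp add: app_bdry_def to_stream_def)
qed simp

definition bernoulli :: "bool stream measure" where
  "bernoulli = stream_space (measure_pmf (bernoulli_pmf (1/2)))"

lemma prob_space_bernoulli: "prob_space bernoulli"
  unfolding bernoulli_def
  by (intro prob_space.prob_space_stream_space measure_pmf.prob_space_axioms)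

lemma sets_bernoulli [measurable_cong]:
  "sets bernoulli = sets (stream_space (count_space UNIV))"
  unfolding bernoulli_def by (intro sets_stream_space_cong) simp

lemma space_bernoulli [simp]: "space bernoulli = UNIV"
  by (simp add: bernoulli_def space_stream_space)

lemma cylinder_eq_sstart: "cylinder v = sstart UNIV v"
  unfolding cylinder_def
proof (induction v)
  case (Cons y v)
  show ?case by (auto simp: Cons[symmetric])
qed simp

lemma sets_cylinder [measurable]: "cylinder v \<in> sets bernoulli"
  unfolding cylinder_eq_sstart sets_bernoulli by (rule sets_sstart)

lemma emeasure_cylinder: "emeasure bernoulli (cylinder v) = ennreal ((1/2) ^ length v)"
proof (induction v)
  case Nil
  show ?case
    using prob_space.emeasure_space_1[OF prob_space_bernoulli] by (simp add: cylinder_def)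
next
  case (Cons y v)
  have S: "cylinder (y # v) \<in> sets (stream_space (measure_pmf (bernoulli_pmf (1/2))))"
    using sets_cylinder unfolding bernoulli_def .
  have "emeasure bernoulli (cylinder (y # v)) =
      (\<integral>\<^sup>+t. emeasure bernoulli {x. t ## x \<in> cylinder (y # v)} \<partial>measure_pmf (bernoulli_pmf (1/2)))"
    using prob_space.emeasure_stream_space[OF measure_pmf.prob_space_axioms S]
    by (simp add: bernoulli_def space_stream_space)
  also have "\<dots> = (\<integral>\<^sup>+t. ennreal ((1/2) ^ length v) * indicator {y} t \<partial>measure_pmf (bernoulli_pmf (1/2)))"
  proof (rule nn_integral_cong)
    fix t
    have "{x. t ## x \<in> cylinder (y # v)} = (if t = y then cylinder v else {})"
      by (auto simp: cylinder_def)
    then show "emeasure bernoulli {x. t ## x \<in> cylinder (y # v)} =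
        ennreal ((1/2) ^ length v) * indicator {y} t"
      by (simp add: Cons)
  qed
  also have "\<dots> = ennreal ((1/2) ^ length v) * ennreal (1/2)"
    by (cases y) (simp_all add: nn_integral_cmult emeasure_pmf_single)
  also have "\<dots> = ennreal ((1/2) ^ length (y # v))"
    by (subst ennreal_mult[symmetric]) (simp_all add: mult.commute)
  finally show ?case .
qed

lemma measurable_app_bdry [measurable]: "app_bdry g \<in> measurable bernoulli bernoulli"
proof -
  have "(\<lambda>x. app_bdry g x !! n) \<in> measurable bernoulli (count_space UNIV)" for n
  proof -
    have "app_bdry g x !! n = app_word g (stake (Suc n) x) ! n" for x
      by (simp add: app_bdry_def to_stream_def)
    moreover have "(\<lambda>x. app_word g (stake (Suc n) x) ! n) \<in> measurable bernoulli (count_space UNIV)"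
      by measurable
    ultimately show ?thesis by simp
  qed
  then have "app_bdry g \<in> measurable bernoulli (stream_space (count_space UNIV))"
    by (rule measurable_stream_space2)
  then show ?thesis by (simp cong: measurable_cong_sets add: sets_bernoulli)
qed

lemma distr_app_bdry: "distr bernoulli bernoulli (app_bdry g) = bernoulli"
proof (rule stream_space_eq_sstart[where S=UNIV])
  show "prob_space (distr bernoulli bernoulli (app_bdry g))"
    by (intro prob_space.prob_space_distr prob_space_bernoulli measurable_app_bdry)
  fix v :: "bool list"
  obtain u where u: "app_word g u = v" using app_word_bij[of g] by (metis bij_pointE)
  have "app_bdry g -` cylinder v = cylinder u"
  proof -
    have "stake (length v) (app_bdry g x) = v \<longleftrightarrow> stake (length u) x = u" for x
      using app_word_bij[of g] unfolding stake_app_bdry u[symmetric]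
      by (auto simp: bij_def inj_def)
    then show ?thesis by (auto simp: cylinder_def)
  qed
  moreover have "length u = length v" using u by auto
  ultimately show "emeasure (distr bernoulli bernoulli (app_bdry g)) (sstart UNIV v) =
      emeasure bernoulli (sstart UNIV v)"
    by (subst emeasure_distr) (simp_all add: cylinder_eq_sstart[symmetric] emeasure_cylinder)
qed (auto simp: prob_space_bernoulli sets_bernoulli)


section \<open>The Hilbert space of square-integrable functions\<close>

definition sq_integrable :: "(bool stream \<Rightarrow> complex) \<Rightarrow> bool" where
  "sq_integrable f \<longleftrightarrow> f \<in> borel_measurable bernoulli \<and> integrable bernoulli (\<lambda>x. (norm (f x))\<^sup>2)"

definition L2_rel :: "(bool stream \<Rightarrow> complex) \<Rightarrow> (bool stream \<Rightarrow> complex) \<Rightarrow> bool" where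
  "L2_rel f g \<longleftrightarrow> sq_integrable f \<and> sq_integrable g \<and> (AE x in bernoulli. f x = g x)"

lemma sq_integrable_zero: "sq_integrable (\<lambda>_. 0)"
  by (simp add: sq_integrable_def)

quotient_type L2 = "bool stream \<Rightarrow> complex" / partial: L2_rel
proof (rule part_equivpI)
  show "\<exists>f. L2_rel f f"
    using sq_integrable_zero by (auto simp: L2_rel_def intro!: exI[of _ "\<lambda>_. 0"])
  show "symp L2_rel"
    unfolding L2_rel_def by (auto intro!: sympI elim: AE_mp)
  show "transp L2_rel"
  proof (rule transpI)
    fix f g h assume "L2_rel f g" "L2_rel g h"
    then show "L2_rel f h" unfolding L2_rel_def by (auto elim: AE_mp)
  qed
qed

lemma sq_integrable_mult:
  assumes "sq_integrable f" "sq_integrable g"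
  shows "integrable bernoulli (\<lambda>x. norm (f x) * norm (g x))"
proof (rule Bochner_Integration.integrable_bound)
  show "integrable bernoulli (\<lambda>x. (norm (f x))\<^sup>2 + (norm (g x))\<^sup>2)"
    using assms by (auto simp: sq_integrable_def)
  have [measurable]: "f \<in> borel_measurable bernoulli" "g \<in> borel_measurable bernoulli"
    using assms by (auto simp: sq_integrable_def)
  show "(\<lambda>x. norm (f x) * norm (g x)) \<in> borel_measurable bernoulli" by measurable
  have "norm (norm (f x) * norm (g x)) \<le> norm ((norm (f x))\<^sup>2 + (norm (g x))\<^sup>2)" for x
  proof -
    have "2 * norm (f x) * norm (g x) \<le> (norm (f x))\<^sup>2 + (norm (g x))\<^sup>2"
      by (rule sum_squares_bound)
    moreover have "0 \<le> norm (f x) * norm (g x)" by simp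
    moreover have "0 \<le> (norm (f x))\<^sup>2 + (norm (g x))\<^sup>2" by simp
    ultimately show ?thesis unfolding real_norm_def by linarith
  qed
  then show "AE x in bernoulli. norm (norm (f x) * norm (g x)) \<le> norm ((norm (f x))\<^sup>2 + (norm (g x))\<^sup>2)"
    by simp
qed

lemma sq_integrable_inner:
  assumes "sq_integrable f" "sq_integrable g"
  shows "integrable bernoulli (\<lambda>x. f x \<bullet> g x)"
proof (rule Bochner_Integration.integrable_bound[OF sq_integrable_mult[OF assms]])
  have [measurable]: "f \<in> borel_measurable bernoulli" "g \<in> borel_measurable bernoulli"
    using assms by (auto simp: sq_integrable_def)
  show "(\<lambda>x. f x \<bullet> g x) \<in> borel_measurable bernoulli" by measurable
  show "AE x in bernoulli. norm (f x \<bullet> g x) \<le> norm (norm (f x) * norm (g x))"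
    by (rule AE_I2) (simp add: abs_mult Cauchy_Schwarz_ineq2)
qed

lemma sq_integrable_add:
  assumes "sq_integrable f" "sq_integrable g"
  shows "sq_integrable (\<lambda>x. f x + g x)"
proof -
  have [measurable]: "f \<in> borel_measurable bernoulli" "g \<in> borel_measurable bernoulli"
    using assms by (auto simp: sq_integrable_def)
  have "(\<lambda>x. (norm (f x + g x))\<^sup>2) = (\<lambda>x. (norm (f x))\<^sup>2 + (norm (g x))\<^sup>2 + 2 * (f x \<bullet> g x))"
    by (auto simp: power2_norm_eq_inner inner_add_left inner_add_right inner_commute)
  moreover have "integrable bernoulli \<dots>"
    using assms sq_integrable_inner[OF assms] by (auto simp: sq_integrable_def)
  ultimately show ?thesis by (simp add: sq_integrable_def)
qed

lemma sq_integrable_cmult: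
  assumes "sq_integrable f"
  shows "sq_integrable (\<lambda>x. c * f x)"
  using assms by (auto simp: sq_integrable_def norm_mult power_mult_distrib)

lemma sq_integrable_indicator:
  assumes "A \<in> sets bernoulli"
  shows "sq_integrable (indicator A)"
proof -
  interpret prob_space bernoulli by (rule prob_space_bernoulli)
  have "integrable bernoulli (\<lambda>x. (norm (indicator A x :: complex))\<^sup>2)"
    using assms by (intro integrable_const_bound[of _ 1]) (auto simp: indicator_def)
  with assms show ?thesis by (simp add: sq_integrable_def)
qed

instantiation L2 :: real_inner
begin

lift_definition zero_L2 :: L2 is "\<lambda>_. 0"
  by (simp add: L2_rel_def sq_integrable_zero)

lift_definition plus_L2 :: "L2 \<Rightarrow> L2 \<Rightarrow> L2" is "\<lambda>f g x. f x + g x"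
  by (auto simp: L2_rel_def sq_integrable_add)

lift_definition uminus_L2 :: "L2 \<Rightarrow> L2" is "\<lambda>f x. - f x"
  by (auto simp: L2_rel_def sq_integrable_def)

definition minus_L2 :: "L2 \<Rightarrow> L2 \<Rightarrow> L2" where
  "minus_L2 f g = f + - g"

lift_definition scaleR_L2 :: "real \<Rightarrow> L2 \<Rightarrow> L2" is "\<lambda>r f x. r *\<^sub>R f x"
  by (auto simp: L2_rel_def scaleR_conv_of_real sq_integrable_cmult)

text \<open>The real part of the Hermitian inner product; it induces the usual norm.\<close>

lift_definition inner_L2 :: "L2 \<Rightarrow> L2 \<Rightarrow> real" is "\<lambda>f g. LINT x|bernoulli. f x \<bullet> g x"
proof -
  fix f f' g g' assume rel: "L2_rel f f'" "L2_rel g g'"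
  then have [measurable]: "f \<in> borel_measurable bernoulli" "f' \<in> borel_measurable bernoulli"
      "g \<in> borel_measurable bernoulli" "g' \<in> borel_measurable bernoulli"
    by (auto simp: L2_rel_def sq_integrable_def)
  show "(LINT x|bernoulli. f x \<bullet> g x) = (LINT x|bernoulli. f' x \<bullet> g' x)"
    using rel by (intro integral_cong_AE) (auto simp: L2_rel_def)
qed

definition norm_L2 :: "L2 \<Rightarrow> real" where
  "norm_L2 f = sqrt (f \<bullet> f)"

definition dist_L2 :: "L2 \<Rightarrow> L2 \<Rightarrow> real" where
  "dist_L2 f g = norm (f - g)"

definition sgn_L2 :: "L2 \<Rightarrow> L2" where
  "sgn_L2 f = inverse (norm f) *\<^sub>R f"

definition uniformity_L2 :: "(L2 \<times> L2) filter" where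
  "uniformity_L2 = (INF e\<in>{0<..}. principal {(f, g). dist f g < e})"

definition open_L2 :: "L2 set \<Rightarrow> bool" where
  "open_L2 U \<longleftrightarrow> (\<forall>f\<in>U. eventually (\<lambda>(f', g). f' = f \<longrightarrow> g \<in> U) uniformity)"

instance
proof
  fix f g h :: L2 and r s :: real
  show "f + g + h = f + (g + h)"
    by transfer (auto simp: L2_rel_def sq_integrable_add add.assoc)
  show "f + g = g + f"
    by transfer (auto simp: L2_rel_def sq_integrable_add add.commute)
  show "0 + f = f"
    by transfer (auto simp: L2_rel_def)
  show "- f + f = 0"
    by transfer (auto simp: L2_rel_def sq_integrable_zero)
  show "f - g = f + - g"
    by (simp add: minus_L2_def)
  show "r *\<^sub>R (f + g) = r *\<^sub>R f + r *\<^sub>R g"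
    by transfer (auto simp: L2_rel_def scaleR_conv_of_real sq_integrable_add sq_integrable_cmult distrib_left
        intro: sq_integrable_cmult[OF sq_integrable_add, simplified distrib_left])
  show "(r + s) *\<^sub>R f = r *\<^sub>R f + s *\<^sub>R f"
    by transfer (auto simp: L2_rel_def scaleR_conv_of_real sq_integrable_add sq_integrable_cmult
        distrib_right intro: sq_integrable_cmult[of _ "of_real r + of_real s", simplified distrib_right])
  show "r *\<^sub>R s *\<^sub>R f = (r * s) *\<^sub>R f"
    by transfer (auto simp: L2_rel_def scaleR_conv_of_real sq_integrable_cmult mult.assoc)
  show "1 *\<^sub>R f = f"
    by transfer (auto simp: L2_rel_def)
  show "sgn f = inverse (norm f) *\<^sub>R f" by (rule sgn_L2_def)
  show "dist f g = norm (f - g)" by (rule dist_L2_def)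
  show "uniformity = (INF e\<in>{0<..}. principal {(f, g :: L2). dist f g < e})"
    by (rule uniformity_L2_def)
  show "open U \<longleftrightarrow> (\<forall>f\<in>U. eventually (\<lambda>(f', g). f' = f \<longrightarrow> g \<in> U) uniformity)" for U :: "L2 set"
    by (rule open_L2_def)
  show "f \<bullet> g = g \<bullet> f"
    by transfer (simp add: inner_commute)
  show "(f + g) \<bullet> h = f \<bullet> h + g \<bullet> h"
    by transfer (simp add: L2_rel_def inner_add_left sq_integrable_inner)
  show "(r *\<^sub>R f) \<bullet> g = r * (f \<bullet> g)"
    by transfer simp
  show "0 \<le> f \<bullet> f"
    by transfer simp
  show "f \<bullet> f = 0 \<longleftrightarrow> f = 0"
    by transfer
      (auto simp: L2_rel_def sq_integrable_zero sq_integrable_inner integral_nonneg_eq_0_iff_AE)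
  show "norm f = sqrt (f \<bullet> f)" by (rule norm_L2_def)
qed

end

lift_definition scaleC_L2 :: "complex \<Rightarrow> L2 \<Rightarrow> L2" is "\<lambda>c f x. c * f x"
  by (auto simp: L2_rel_def sq_integrable_cmult)

lemma vector_space_scaleC_L2: "vector_space scaleC_L2"
proof
  fix c d :: complex and f g :: L2
  show "scaleC_L2 c (f + g) = scaleC_L2 c f + scaleC_L2 c g"
    by transfer (auto simp: L2_rel_def sq_integrable_add sq_integrable_cmult distrib_left
        intro: sq_integrable_cmult[OF sq_integrable_add, simplified distrib_left])
  show "scaleC_L2 (c + d) f = scaleC_L2 c f + scaleC_L2 d f"
    by transfer (auto simp: L2_rel_def sq_integrable_add sq_integrable_cmult distrib_right
        intro: sq_integrable_cmult[of _ "c + d", simplified distrib_right])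
  show "scaleC_L2 c (scaleC_L2 d f) = scaleC_L2 (c * d) f"
    by transfer (auto simp: L2_rel_def sq_integrable_cmult mult.assoc
        intro: sq_integrable_cmult[of _ "c * d", simplified mult.assoc])
  show "scaleC_L2 1 f = f"
    by transfer (auto simp: L2_rel_def)
qed

lift_definition char_cylinder :: "bool list \<Rightarrow> L2" is "\<lambda>v. indicator (cylinder v)"
  by (simp add: L2_rel_def sq_integrable_indicator)

definition H_cyl :: "nat \<Rightarrow> L2 set" where
  "H_cyl n = module.span scaleC_L2 (char_cylinder ` {v. length v = n})"


section \<open>The Koopman representation and the spectra\<close>

text \<open>\<open>(\<pi>\<^sub>g f)(x) = f (g\<inverse> x)\<close>\<close>

lift_definition koopman_fun :: "tree_aut \<Rightarrow> L2 \<Rightarrow> L2" is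
  "\<lambda>g f x. f (app_bdry (inv\<^bsub>Aut_tree\<^esub> g) x)"
proof -
  fix g f f' assume rel: "L2_rel f f'"
  let ?T = "app_bdry (inv\<^bsub>Aut_tree\<^esub> g)"
  have sq: "sq_integrable (\<lambda>x. u (?T x))" if "sq_integrable u" for u
  proof -
    have [measurable]: "u \<in> borel_measurable bernoulli"
      using that by (simp add: sq_integrable_def)
    have "integrable (distr bernoulli bernoulli ?T) (\<lambda>x. (norm (u x))\<^sup>2)"
      using that by (simp add: distr_app_bdry sq_integrable_def)
    then show ?thesis
      by (subst (asm) integrable_distr_eq) (auto simp: sq_integrable_def)
  qed
  have "AE x in distr bernoulli bernoulli ?T. f x = f' x"
    unfolding distr_app_bdry using rel by (simp add: L2_rel_def)
  then have "AE x in bernoulli. f (?T x) = f' (?T x)"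
    using AE_distrD[OF measurable_app_bdry] by blast
  with rel sq show "L2_rel (\<lambda>x. f (?T x)) (\<lambda>x. f' (?T x))"
    by (simp add: L2_rel_def)
qed

lemma inner_koopman_fun: "koopman_fun g f \<bullet> koopman_fun g h = f \<bullet> h"
proof transfer
  fix g f h assume "L2_rel f f" "L2_rel h h"
  then have [measurable]: "f \<in> borel_measurable bernoulli" "h \<in> borel_measurable bernoulli"
    by (auto simp: L2_rel_def sq_integrable_def)
  have "(LINT x|bernoulli. f x \<bullet> h x) =
      (LINT x|distr bernoulli bernoulli (app_bdry (inv\<^bsub>Aut_tree\<^esub> g)). f x \<bullet> h x)"
    by (simp add: distr_app_bdry)
  then show "(LINT x|bernoulli. f (app_bdry (inv\<^bsub>Aut_tree\<^esub> g) x) \<bullet> h (app_bdry (inv\<^bsub>Aut_tree\<^esub> g) x)) =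
      (LINT x|bernoulli. f x \<bullet> h x)"
    by (simp add: integral_distr)
qed

lemma bounded_linear_koopman_fun: "bounded_linear (koopman_fun g)"
proof (rule bounded_linear_intro[where K=1])
  have rel: "L2_rel (\<lambda>x. f (app_bdry (inv\<^bsub>Aut_tree\<^esub> g) x)) (\<lambda>x. f (app_bdry (inv\<^bsub>Aut_tree\<^esub> g) x))"
    if "L2_rel f f" for g f
    using koopman_fun.rsp that unfolding rel_fun_def by blast
  show "koopman_fun g (f + h) = koopman_fun g f + koopman_fun g h" for f h
    by transfer (use rel in \<open>auto simp: L2_rel_def sq_integrable_add\<close>)
  show "koopman_fun g (r *\<^sub>R f) = r *\<^sub>R koopman_fun g f" for r f
    by transfer (use rel in \<open>auto simp: L2_rel_def scaleR_conv_of_real sq_integrable_cmult\<close>)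
  show "norm (koopman_fun g f) \<le> norm f * 1" for f
    by (simp add: norm_eq_sqrt_inner inner_koopman_fun)
qed

lift_definition koopman :: "tree_aut \<Rightarrow> L2 \<Rightarrow>\<^sub>L L2" is koopman_fun
  by (rule bounded_linear_koopman_fun)

definition Mop :: "real \<times> real \<times> real \<Rightarrow> L2 \<Rightarrow>\<^sub>L L2" where
  "Mop = (\<lambda>(y, z, l). koopman gen_a + y *\<^sub>R koopman gen_b + z *\<^sub>R koopman gen_c - l *\<^sub>R id_blinfun)"

text \<open>
  Blinfuns are only real-linear, but the inverse of a complex-linear map is complex-linear, so this
  agrees with invertibility in the algebra of bounded complex-linear operators.
\<close>

definition invertible_op :: "(L2 \<Rightarrow>\<^sub>L L2) \<Rightarrow> bool" where
  "invertible_op T \<longleftrightarrow> (\<exists>S. S o\<^sub>L T = id_blinfun \<and> T o\<^sub>L S = id_blinfun)"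

definition sp :: "(real \<times> real \<times> real) set" where
  "sp = {p. \<not> invertible_op (Mop p)}"

text \<open>A linear endomorphism of the finite-dimensional space \<open>H_cyl n\<close> is invertible iff it is bijective.\<close>

definition sp_fin :: "nat \<Rightarrow> (real \<times> real \<times> real) set" where
  "sp_fin n = {p. \<not> bij_betw (blinfun_apply (Mop p)) (H_cyl n) (H_cyl n)}"


section \<open>The rational map\<close>

definition P_plane :: "(real \<times> real \<times> real) set" where
  "P_plane = {(y, z, l). 1 + y + z - l = 0}"

definition Z1 :: "(real \<times> real \<times> real) set" where
  "Z1 = {(y, z, l). (z - l - y) * (z - l + y) = 0}"

definition Z2 :: "(real \<times> real \<times> real) set" where
  "Z2 = {(y, z, l). y = 0 \<and> (1 - (l - z) * (l + z)) * (1 - l + z) * (1 + l - z) = 0}"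

definition F_map :: "real \<times> real \<times> real \<Rightarrow> real \<times> real \<times> real" where
  "F_map = (\<lambda>(y, z, l).
     (z / y,
      1 / (- y\<^sup>2 + z\<^sup>2 - 2 * z * l + l\<^sup>2),
      (- l * y\<^sup>2 + l * z\<^sup>2 - 2 * z * l\<^sup>2 + l ^ 3 + z - l) / (y * (- y\<^sup>2 + z\<^sup>2 - 2 * z * l + l\<^sup>2))))"

definition dom_F :: "(real \<times> real \<times> real) set" where
  "dom_F = {(y, z, l). y \<noteq> 0} - Z1"

text \<open>\<open>F_preimage i S\<close> is \<open>F_map\<^sup>-\<^sup>i(S)\<close>: the points at which the \<open>i\<close>-th iterate is defined, with value in \<open>S\<close>.\<close>

definition F_preimage :: "nat \<Rightarrow> (real \<times> real \<times> real) set \<Rightarrow> (real \<times> real \<times> real) set" where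
  "F_preimage i S = {p. (\<forall>j<i. (F_map ^^ j) p \<in> dom_F) \<and> (F_map ^^ i) p \<in> S}"

definition Z3 :: "(real \<times> real \<times> real) set" where
  "Z3 = Z2 \<union> F_preimage 1 Z2"

end

(*
  Splitting functions on the boundary by their first letter turns the restriction of the operator to
  H_{n+1} into a 2x2 block matrix over H_n. Where its lower right block is invertible, the Schur
  complement is y times the operator at F(y,z,l) on H_n, so sp_{n+1} is the F-preimage of sp_n there;
  on the plane y = 0 the same elimination gives exactly Z2, and F^{-2}(Z2) is empty.
  The union of the H_n is dense in L2 and the operator is symmetric. If no point of the vertical
  segment of radius e about p lies in any sp_n, then all eigenvalues of the operator on the H_n have
  modulus at least e, hence the operator is bounded below by e and invertible.
*)
theory Submission
  imports Defs
begin

section \<open>The kernel on words\<close>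

definition word_op :: "real \<times> real \<times> real \<Rightarrow> (bool list \<Rightarrow> complex) \<Rightarrow> bool list \<Rightarrow> complex" where
  "word_op = (\<lambda>(y, z, l) u v. u (word_a v) + of_real y * u (word_b v) + of_real z * u (word_c v)
     - of_real l * u v)"

text \<open>A coefficient function is total on words of all lengths, but only its values at length
  \<open>n\<close> matter, because the generators preserve length. They are involutions, so the
  inverse in the Koopman representation does not show in \<open>word_op\<close>.\<close>

definition word_sp :: "nat \<Rightarrow> (real \<times> real \<times> real) set" where
  "word_sp n = {p. \<exists>u. (\<exists>v. length v = n \<and> u v \<noteq> 0) \<and> (\<forall>v. length v = n \<longrightarrow> word_op p u v = 0)}"

lemma word_spI:
  assumes "length v = n" "u v \<noteq> 0" "\<And>v. length v = n \<Longrightarrow> word_op p u v = 0"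
  shows "p \<in> word_sp n"
  using assms unfolding word_sp_def by blast

lemma length_word_gens [simp]:
  "length (word_a w) = length w" "length (word_b w) = length w" "length (word_c w) = length w"
  using length_app_word[of gen_a w] length_app_word[of gen_b w] length_app_word[of gen_c w]
  by (simp_all add: gen_a.rep_eq gen_b.rep_eq gen_c.rep_eq)

text \<open>The wreath recursion as a block matrix: a exchanges the halves and gives identities off
  the diagonal; b = (a, c) and c = (b, 1) give the diagonal blocks ya + zb - l and yc + z -
  l.\<close>

lemma word_op_Cons:
  "word_op (y, z, l) u (False # w) = u (True # w) + of_real y * u (False # word_a w)
     + of_real z * u (False # word_b w) - of_real l * u (False # w)"
  "word_op (y, z, l) u (True # w) = u (False # w) + of_real y * u (True # word_c w)
     + of_real z * u (True # w) - of_real l * u (True # w)"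
  by (simp_all add: word_op_def)

lemma word_sp_0: "word_sp 0 = P_plane"
proof -
  have eq: "word_op (y, z, l) u [] = of_real (1 + y + z - l) * u []" for y z l u
    by (simp add: word_op_def algebra_simps)
  have "p \<in> word_sp 0 \<longleftrightarrow> p \<in> P_plane" for p
  proof (cases p)
    case (fields y z l)
    have "p \<in> word_sp 0 \<longleftrightarrow> (\<exists>u :: bool list \<Rightarrow> complex. u [] \<noteq> 0) \<and> 1 + y + z - l = 0"
      unfolding word_sp_def mem_Collect_eq length_0_conv simp_thms fields eq mult_eq_0_iff of_real_eq_0_iff
      by blast
    also have "\<dots> \<longleftrightarrow> p \<in> P_plane"
      by (auto simp: P_plane_def fields intro: exI[of _ "\<lambda>_. 1"])
    finally show ?thesis .
  qed
  then show ?thesis by blast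
qed

text \<open>
  The system at a point of the domain of \<open>F\<close> is solved for \<open>u (True # w)\<close> in terms of the
  \<open>u (False # w)\<close>; the Schur complement of that block is \<open>y\<close> times the operator at the image point.
\<close>

lemma word_sp_Suc_iff_F:
  assumes "p \<in> dom_F"
  shows "p \<in> word_sp (Suc n) \<longleftrightarrow> F_map p \<in> word_sp n"
proof (cases p)
  case (fields y z l)
  \<comment> \<open>The block to be inverted is yc + s. As c is an involution, (yc + s)(s - yc) =
    s^2 - y^2 = D, so its inverse is (s - yc) / D.\<close>
  define s where "s = z - l"
  define D where "D = s\<^sup>2 - y\<^sup>2"
  have y: "y \<noteq> 0" and "(s - y) * (s + y) \<noteq> 0"
    using assms by (auto simp: fields dom_F_def Z1_def s_def)
  then have D: "D \<noteq> 0" by (simp add: D_def power2_eq_square algebra_simps)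
  have Dc: "(of_real D :: complex) = of_real s * of_real s - of_real y * of_real y"
    by (simp add: D_def power2_eq_square)
  have D0: "(of_real D :: complex) \<noteq> 0" using D by simp
  have D': "- y\<^sup>2 + z\<^sup>2 - 2 * z * l + l\<^sup>2 = D"
    by (simp add: D_def s_def power2_eq_square algebra_simps)
  have N: "- l * y\<^sup>2 + l * z\<^sup>2 - 2 * z * l\<^sup>2 + l ^ 3 + z - l = l * D + s"
    by (simp add: D_def s_def power2_eq_square power3_eq_cube algebra_simps)
  have Fp: "F_map p = (z / y, 1 / D, (l * D + s) / (y * D))"
    unfolding fields F_map_def split_conv D' N ..
  \<comment> \<open>D times the Schur complement ya + zb - l + (yc - s) / D. Dividing the complement
    by y makes the coefficient of a equal to 1 and leaves the coordinates of F.\<close>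
  have FM: "of_real (y * D) * word_op (F_map p) u w =
      of_real D * (of_real y * u (word_a w) + of_real z * u (word_b w) - of_real l * u w)
      + of_real y * u (word_c w) - of_real s * u w" for u w
    unfolding Fp word_op_def split_conv using y D by (simp add: field_simps)
  show ?thesis
  proof
    assume "p \<in> word_sp (Suc n)"
    then obtain u v where uv: "length v = Suc n" "u v \<noteq> 0"
      and ker: "\<And>v. length v = Suc n \<Longrightarrow> word_op p u v = 0"
      unfolding word_sp_def by blast
    define u0 where "u0 w = u (False # w)" for w
    define u1 where "u1 w = u (True # w)" for w
    have e0: "u1 w + of_real y * u0 (word_a w) + of_real z * u0 (word_b w) - of_real l * u0 w = 0"
      and e1: "u0 w + of_real y * u1 (word_c w) + of_real s * u1 w = 0" if "length w = n" for w
      using ker[of "False # w"] ker[of "True # w"] that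
      unfolding fields word_op_Cons by (simp_all add: u0_def u1_def s_def algebra_simps)
    \<comment> \<open>Apply s - yc to the second row: s times the row at \<open>w\<close> minus y
      times the row at \<open>word_c w\<close> cancels \<open>u1 (word_c w)\<close>.\<close>
    have u1: "of_real D * u1 w = of_real y * u0 (word_c w) - of_real s * u0 w" if "length w = n" for w
    proof -
      have "of_real s * (u0 w + of_real y * u1 (word_c w) + of_real s * u1 w)
          - of_real y * (u0 (word_c w) + of_real y * u1 w + of_real s * u1 (word_c w)) = 0"
        using e1[OF that] e1[of "word_c w"] that by (simp add: word_bc_invol)
      then show ?thesis unfolding Dc by (simp add: algebra_simps)
    qed
    show "F_map p \<in> word_sp n"
    proof (rule ccontr)
      assume no: "F_map p \<notin> word_sp n"
      have op: "word_op (F_map p) u0 w = 0" if "length w = n" for w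
      proof -
        have "of_real (y * D) * word_op (F_map p) u0 w = of_real D * (of_real y * u0 (word_a w)
            + of_real z * u0 (word_b w) - of_real l * u0 w) + of_real D * u1 w"
          unfolding FM u1[OF that] by simp
        also have "\<dots> = 0" using e0[OF that] by algebra
        finally show ?thesis using y D by simp
      qed
      have u00: "u0 w = 0" if "length w = n" for w
        using word_spI[of w n u0, OF that _ op] no by blast
      then have "u1 w = 0" if "length w = n" for w
        using u1[OF that] that D by simp
      moreover obtain x w where v: "v = x # w" using uv(1) by (cases v) auto
      ultimately show False
        using u00[of w] uv by (cases x) (simp_all add: v u0_def u1_def)
    qed
  next
    assume "F_map p \<in> word_sp n"
    then obtain u0 v where uv: "length v = n" "u0 v \<noteq> 0"
      and ker: "\<And>v. length v = n \<Longrightarrow> word_op (F_map p) u0 v = 0"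
      unfolding word_sp_def by blast
    define u1 where "u1 w = (of_real y * u0 (word_c w) - of_real s * u0 w) / of_real D" for w
    define u where "u v = (if hd v then u1 (tl v) else u0 (tl v))" for v
    show "p \<in> word_sp (Suc n)"
    proof (rule word_spI[where v = "False # v" and u = u])
      fix v :: "bool list" assume "length v = Suc n"
      then obtain x w where v: "v = x # w" and w: "length w = n" by (cases v) auto
      have Du1: "of_real D * u1 w' = of_real y * u0 (word_c w') - of_real s * u0 w'" for w'
        using D by (simp add: u1_def)
      have "of_real D * word_op p u v = 0"
      proof (cases x)
        case True
        have "of_real D * word_op p u v =
            of_real D * u0 w + of_real y * (of_real D * u1 (word_c w)) + of_real s * (of_real D * u1 w)"
          using True by (simp add: v fields word_op_Cons u_def s_def algebra_simps)
        also have "\<dots> = 0"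
          unfolding Du1 word_bc_invol unfolding Dc by algebra
        finally show ?thesis .
      next
        case False
        have "of_real D * word_op p u v = of_real (y * D) * word_op (F_map p) u0 w"
          unfolding FM using False Du1[of w] by (simp add: v fields word_op_Cons u_def algebra_simps)
        then show ?thesis using ker[OF w] by simp
      qed
      with D0 show "word_op p u v = 0" by simp
    qed (use uv in \<open>auto simp: u_def\<close>)
  qed
qed

text \<open>With y = 0 the lower block is the scalar z - l, which may vanish; hence
  \<open>u0\<close> is expressed through \<open>u1\<close>, without division. The first row becomes
  A + B b applied to \<open>u1\<close>, and as b is an involution a kernel vector forces A^2 =
  B^2.\<close>

lemma word_sp_Suc_y0:
  assumes "(0, z, l) \<in> word_sp (Suc n)"
  shows "(0, z, l) \<in> Z2"
proof -
  obtain u v where uv: "length v = Suc n" "u v \<noteq> 0"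
    and ker: "\<And>v. length v = Suc n \<Longrightarrow> word_op (0, z, l) u v = 0"
    using assms unfolding word_sp_def by blast
  define u0 where "u0 w = u (False # w)" for w
  define u1 where "u1 w = u (True # w)" for w
  have e0: "u1 w + of_real z * u0 (word_b w) - of_real l * u0 w = 0"
    and e1: "u0 w = (of_real l - of_real z) * u1 w" if "length w = n" for w
    using ker[of "False # w"] ker[of "True # w"] that
    unfolding word_op_Cons by (simp_all add: u0_def u1_def algebra_simps)
  obtain x w where v: "v = x # w" using uv(1) by (cases v) auto
  have w: "length w = n" "u1 w \<noteq> 0"
    using uv e1[of w] by (cases x; simp add: v u0_def u1_def)+
  let ?k = "(1 - (l - z) * (l + z)) * (1 - l + z) * (1 + l - z)"
  \<comment> \<open>A + B = 1 - (l - z)^2 and A - B = 1 - (l - z)(l + z) belong to the eigenvalues 1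
    and -1 of b; their product is the polynomial defining \<open>Z2\<close>.\<close>
  define A :: complex where "A = of_real (1 - (l - z) * l)"
  define B :: complex where "B = of_real ((l - z) * z)"
  have "A * u1 w + B * u1 (word_b w) = 0" "A * u1 (word_b w) + B * u1 w = 0"
    using e0[OF w(1)] e0[of "word_b w"] w(1) unfolding word_bc_invol
    by (simp_all add: e1 A_def B_def algebra_simps)
  moreover have "(A * A - B * B) * u1 w =
      A * (A * u1 w + B * u1 (word_b w)) - B * (A * u1 (word_b w) + B * u1 w)"
    by (simp add: algebra_simps)
  moreover have "A * A - B * B = of_real ?k"
    unfolding A_def B_def of_real_mult[symmetric] of_real_diff[symmetric]
    by (simp add: algebra_simps)
  ultimately have "of_real ?k * u1 w = 0" by simp
  with w(2) have "?k = 0" by (simp only: mult_eq_0_iff of_real_eq_0_iff) simp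
  then show ?thesis by (simp add: Z2_def)
qed

text \<open>The eigenvalue \<open>-1\<close> of \<open>b\<close> first occurs on words of length 2, hence the level 3.\<close>

lemma Z2_subset_word_sp: "Z2 \<subseteq> word_sp 3"
proof
  fix p assume p: "p \<in> Z2"
  then obtain z l where pz: "p = (0, z, l)" by (auto simp: Z2_def)
  define s where "s = l - z"
  \<comment> \<open>On length 2, b acts as a below the letter 0, so it swaps these two words, and it
    fixes the other two; thus \<open>chi\<close> is an eigenvector for -1.\<close>
  define chi :: "bool list \<Rightarrow> complex" where
    "chi w = (if w = [False, False] then 1 else if w = [False, True] then -1 else 0)" for w
  have chi_b: "chi (word_b w) = - chi w" if "length w = 2" for w
    using that by (auto simp: chi_def length_Suc_conv numeral_2_eq_2)
  have "(1 - s * (l + z)) * (1 - s\<^sup>2) = (1 - (l - z) * (l + z)) * (1 - l + z) * (1 + l - z)"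
    by (simp add: s_def power2_eq_square algebra_simps)
  also have "\<dots> = 0" using p by (simp add: pz Z2_def)
  finally consider "s\<^sup>2 = 1" | "s * (l + z) = 1" by auto
  then show "p \<in> word_sp 3"
  proof cases
    case 1
    \<comment> \<open>Both witnesses are f on the half below 1 and s f on the half below 0, with f
      an eigenvector of b: here the constant 1, in the other case \<open>chi\<close>.\<close>
    show ?thesis
    proof (rule word_spI[where v = "[True, True, True]" and u = "\<lambda>v. if hd v then 1 else of_real s"])
      fix v :: "bool list" assume "length v = 3"
      then obtain x w where v: "v = x # w" by (cases v) auto
      have "of_real s * of_real s = (1 :: complex)"
        using 1 by (metis of_real_1 of_real_mult power2_eq_square)
      moreover have "of_real l = of_real s + (of_real z :: complex)" by (simp add: s_def)
      ultimately show "word_op p (\<lambda>v. if hd v then 1 else of_real s) v = 0"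
        by (cases x) (simp_all add: v pz word_op_Cons algebra_simps)
    qed auto
  next
    case 2
    let ?u = "\<lambda>v. (if hd v then 1 else of_real s) * chi (tl v)"
    show ?thesis
    proof (rule word_spI[where v = "[True, False, False]" and u = ?u])
      fix v :: "bool list" assume "length v = 3"
      then obtain x w where v: "v = x # w" and w: "length w = 2" by (cases v) auto
      have "of_real s * (of_real l + of_real z) = (1 :: complex)"
        using 2 by (metis of_real_1 of_real_mult of_real_add)
      then have *: "chi w = chi w * (of_real s * (of_real l + of_real z))" by simp
      have "of_real l = of_real s + (of_real z :: complex)" by (simp add: s_def)
      then show "word_op p ?u v = 0"
        using * by (cases x) (simp_all add: v pz word_op_Cons chi_b[OF w] algebra_simps)
    qed (auto simp: chi_def)
  qed
qed

section \<open>Iterated preimages under the rational map\<close>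

lemma F_preimage_0 [simp]: "F_preimage 0 S = S"
  by (simp add: F_preimage_def)

lemma F_preimage_Suc: "p \<in> F_preimage (Suc i) S \<longleftrightarrow> p \<in> dom_F \<and> F_map p \<in> F_preimage i S"
  unfolding F_preimage_def mem_Collect_eq All_less_Suc2 funpow_Suc_right by simp

lemma F_preimage_word_sp: "p \<in> F_preimage i (word_sp n) \<Longrightarrow> p \<in> word_sp (n + i)"
proof (induction i arbitrary: p)
  case (Suc i)
  then show ?case by (simp add: F_preimage_Suc word_sp_Suc_iff_F)
qed simp

lemma F_preimage_mono: "S \<subseteq> T \<Longrightarrow> F_preimage i S \<subseteq> F_preimage i T"
  by (auto simp: F_preimage_def)

lemma preimages_subset_word_sp: "Z3 \<union> (\<Union>i. F_preimage i P_plane) \<subseteq> (\<Union>n. word_sp n)"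
proof -
  have "F_preimage 1 Z2 \<subseteq> word_sp (3 + 1)"
    using F_preimage_mono[OF Z2_subset_word_sp] F_preimage_word_sp by blast
  moreover have "F_preimage i P_plane \<subseteq> word_sp (0 + i)" for i
    unfolding word_sp_0[symmetric] using F_preimage_word_sp by blast
  ultimately show ?thesis
    using Z2_subset_word_sp unfolding Z3_def by blast
qed

text \<open>On its domain F has the nonzero second coordinate 1 / D. After a second application the
  first coordinate z / y is therefore nonzero, while \<open>Z2\<close> lies in the plane y = 0. This
  is why \<open>Z3\<close> stops at the first preimage.\<close>

lemma F_preimage_2_Z2: "F_preimage (Suc (Suc 0)) Z2 = {}"
proof -
  have "p \<notin> F_preimage (Suc (Suc 0)) Z2" for p
  proof (cases p)
    case (fields y z l)
    have "- y\<^sup>2 + z\<^sup>2 - 2 * z * l + l\<^sup>2 = (z - l - y) * (z - l + y)"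
      by (simp add: power2_eq_square algebra_simps)
    then show ?thesis
      by (auto simp: F_preimage_Suc F_map_def Z2_def dom_F_def Z1_def fields)
  qed
  then show ?thesis by blast
qed

text \<open>The plane y = 0, \<open>Z1\<close> and \<open>dom_F\<close> cover all points. On
  \<open>dom_F\<close> the induction hypothesis is pulled back along F, and \<open>Z3\<close> could
  grow only by the second preimage of \<open>Z2\<close>, which is empty.\<close>

lemma word_sp_subset_preimages:
  "word_sp n \<subseteq> Z3 \<union> (\<Union>i. F_preimage i (P_plane \<union> Z1))"
proof (induction n)
  case 0
  have "P_plane \<subseteq> F_preimage 0 (P_plane \<union> Z1)" by simp
  then show ?case unfolding word_sp_0 by blast
next
  case (Suc n)
  show ?case
  proof
    fix p assume p: "p \<in> word_sp (Suc n)"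
    consider "fst p = 0" | "p \<in> Z1" | "p \<in> dom_F" by (cases p) (auto simp: dom_F_def)
    then show "p \<in> Z3 \<union> (\<Union>i. F_preimage i (P_plane \<union> Z1))"
    proof cases
      case 1
      then have "p \<in> Z2" using p word_sp_Suc_y0 by (cases p) auto
      then show ?thesis by (simp add: Z3_def)
    next
      case 2
      then have "p \<in> F_preimage 0 (P_plane \<union> Z1)" by simp
      then show ?thesis by blast
    next
      case 3
      then have "F_map p \<in> Z3 \<union> (\<Union>i. F_preimage i (P_plane \<union> Z1))"
        using p Suc word_sp_Suc_iff_F by blast
      then consider "F_map p \<in> F_preimage 0 Z2" | "F_map p \<in> F_preimage (Suc 0) Z2"
        | i where "F_map p \<in> F_preimage i (P_plane \<union> Z1)" by (auto simp: Z3_def)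
      then show ?thesis
      proof cases
        case 1
        then have "p \<in> F_preimage (Suc 0) Z2" unfolding F_preimage_Suc[of p] using 3 by blast
        then show ?thesis by (simp add: Z3_def)
      next
        case 2
        then have "p \<in> F_preimage (Suc (Suc 0)) Z2" unfolding F_preimage_Suc[of p] using 3 by blast
        then show ?thesis by (simp add: F_preimage_2_Z2)
      next
        case (3 i)
        then have "p \<in> F_preimage (Suc i) (P_plane \<union> Z1)"
          unfolding F_preimage_Suc[of p] using \<open>p \<in> dom_F\<close> by blast
        then show ?thesis by blast
      qed
    qed
  qed
qed

section \<open>Completeness of the Hilbert space and density of the cylinder functions\<close>

lemma L2_cases:
  obtains f where "sq_integrable f" "F = abs_L2 f"
proof
  show "F = abs_L2 (rep_L2 F)" using Quotient_abs_rep[OF Quotient_L2] by metis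
  show "sq_integrable (rep_L2 F)"
    using Quotient_rep_reflp[OF Quotient_L2, of F] by (simp add: L2_rel_def)
qed

lemma L2_rel_refl: "sq_integrable f \<Longrightarrow> L2_rel f f"
  by (simp add: L2_rel_def)

lemma abs_L2_simps:
  assumes "sq_integrable f" "sq_integrable g"
  shows "abs_L2 f + abs_L2 g = abs_L2 (\<lambda>x. f x + g x)"
    and "scaleC_L2 c (abs_L2 f) = abs_L2 (\<lambda>x. c * f x)"
    and "abs_L2 f - abs_L2 g = abs_L2 (\<lambda>x. f x - g x)"
proof -
  show "abs_L2 f + abs_L2 g = abs_L2 (\<lambda>x. f x + g x)"
    using assms by (simp add: plus_L2.abs_eq L2_rel_refl)
  show "scaleC_L2 c (abs_L2 f) = abs_L2 (\<lambda>x. c * f x)"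
    using assms by (simp add: scaleC_L2.abs_eq L2_rel_refl)
  have "sq_integrable (\<lambda>x. - g x)" using sq_integrable_cmult[OF assms(2), of "-1"] by simp
  with assms show "abs_L2 f - abs_L2 g = abs_L2 (\<lambda>x. f x - g x)"
    by (simp add: minus_L2_def plus_L2.abs_eq uminus_L2.abs_eq L2_rel_refl)
qed

lemma norm_abs_L2: "sq_integrable f \<Longrightarrow> (norm (abs_L2 f))\<^sup>2 = (LINT x|bernoulli. (norm (f x))\<^sup>2)"
  by (simp add: power2_norm_eq_inner inner_L2.abs_eq L2_rel_refl)

lemma sq_integrable_diff:
  assumes "sq_integrable f" "sq_integrable g"
  shows "sq_integrable (\<lambda>x. f x - g x)"
  using sq_integrable_add[OF assms(1) sq_integrable_cmult[OF assms(2), of "-1"]] by simp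

lemma sq_integrable_bound:
  assumes "sq_integrable g" "f \<in> borel_measurable bernoulli" "\<And>x. norm (f x) \<le> c * norm (g x)"
  shows "sq_integrable f"
proof -
  have int: "integrable bernoulli (\<lambda>x. c\<^sup>2 * (norm (g x))\<^sup>2)"
    using assms(1) by (simp add: sq_integrable_def)
  have "(norm (f x))\<^sup>2 \<le> c\<^sup>2 * (norm (g x))\<^sup>2" for x
    using power_mono[OF assms(3)[of x], of 2] by (simp add: power_mult_distrib)
  then have "integrable bernoulli (\<lambda>x. (norm (f x))\<^sup>2)"
    by (intro Bochner_Integration.integrable_bound[OF int]) (use assms(2) in auto)
  with assms(2) show ?thesis by (simp add: sq_integrable_def)
qed

text \<open>The squared distances to the limit are dominated by the integrable (2 c)^2 |g|^2. This
  serves both growing unions of sets and approximation by simple functions.\<close>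

lemma L2_dominated_convergence:
  assumes g: "sq_integrable g" and s: "\<And>i. s i \<in> borel_measurable bernoulli"
    and lim: "\<And>x. (\<lambda>i. s i x) \<longlonglongrightarrow> f x"
    and bound: "\<And>i x. norm (s i x) \<le> c * norm (g x)"
  shows "\<And>i. sq_integrable (s i)" "sq_integrable f" "(\<lambda>i. abs_L2 (s i)) \<longlonglongrightarrow> abs_L2 f"
proof -
  note [measurable] = s
  have f_meas [measurable]: "f \<in> borel_measurable bernoulli"
    by (rule borel_measurable_LIMSEQ_metric[OF s lim])
  have f_bound: "norm (f x) \<le> c * norm (g x)" for x
    using bound by (intro LIMSEQ_le_const2[OF tendsto_norm[OF lim]]) auto
  show si: "sq_integrable (s i)" for i
    by (rule sq_integrable_bound[OF g s bound])
  show f: "sq_integrable f"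
    by (rule sq_integrable_bound[OF g f_meas f_bound])
  have "(\<lambda>i. LINT x|bernoulli. (norm (s i x - f x))\<^sup>2) \<longlonglongrightarrow> (LINT x|bernoulli. 0)"
  proof (rule integral_dominated_convergence)
    show "integrable bernoulli (\<lambda>x. (2 * c)\<^sup>2 * (norm (g x))\<^sup>2)"
      using g by (simp add: sq_integrable_def)
    show "AE x in bernoulli. (\<lambda>i. (norm (s i x - f x))\<^sup>2) \<longlonglongrightarrow> 0"
    proof (rule AE_I2)
      fix x
      have "(\<lambda>i. (norm (s i x - f x))\<^sup>2) \<longlonglongrightarrow> (norm (f x - f x))\<^sup>2"
        by (intro tendsto_intros lim)
      then show "(\<lambda>i. (norm (s i x - f x))\<^sup>2) \<longlonglongrightarrow> 0" by simp
    qed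
    show "AE x in bernoulli. norm ((norm (s i x - f x))\<^sup>2) \<le> (2 * c)\<^sup>2 * (norm (g x))\<^sup>2" for i
    proof (rule AE_I2)
      fix x
      have "norm (s i x - f x) \<le> (2 * c) * norm (g x)"
        using norm_triangle_ineq4[of "s i x" "f x"] bound[of i x] f_bound[of x] by linarith
      from power_mono[OF this, of 2]
      show "norm ((norm (s i x - f x))\<^sup>2) \<le> (2 * c)\<^sup>2 * (norm (g x))\<^sup>2"
        by (simp add: power_mult_distrib)
    qed
  qed measurable
  then have "(\<lambda>i. sqrt ((norm (abs_L2 (s i) - abs_L2 f))\<^sup>2)) \<longlonglongrightarrow> sqrt 0"
    by (intro tendsto_real_sqrt)
      (simp add: abs_L2_simps(3)[OF si f] norm_abs_L2[OF sq_integrable_diff[OF si f]])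
  then show "(\<lambda>i. abs_L2 (s i)) \<longlonglongrightarrow> abs_L2 f"
    by (simp add: LIM_zero_iff tendsto_norm_zero_iff)
qed

section \<open>Complex subspaces and density of the cylinder functions\<close>

interpretation L2C: vector_space scaleC_L2
  by (rule vector_space_scaleC_L2)

lemma norm_scaleC_L2: "norm (scaleC_L2 c f) = norm c * norm f"
proof -
  obtain u where u: "sq_integrable u" "f = abs_L2 u" by (rule L2_cases)
  have "(norm (scaleC_L2 c f))\<^sup>2 = (norm c * norm f)\<^sup>2"
    using u by (simp add: abs_L2_simps(2) norm_abs_L2 sq_integrable_cmult power_mult_distrib norm_mult)
  then show ?thesis by simp
qed

lemma H_cyl_mono_Suc: "H_cyl n \<subseteq> H_cyl (Suc n)"
  unfolding H_cyl_def
proof (rule L2C.span_minimal[OF _ L2C.subspace_span], clarify)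
  fix v :: "bool list" assume "n = length v"
  have "indicator (cylinder v) x =
      indicator (cylinder (v @ [False])) x + (indicator (cylinder (v @ [True])) x :: complex)" for x
    by (auto simp: cylinder_def indicator_def stake_Suc simp del: stake.simps(2))
  then have "char_cylinder v = char_cylinder (v @ [False]) + char_cylinder (v @ [True])"
    by transfer (simp add: L2_rel_def sq_integrable_indicator sq_integrable_add)
  also have "\<dots> \<in> L2C.span (char_cylinder ` {w. length w = Suc (length v)})"
    by (intro L2C.span_add L2C.span_base) auto
  finally show "char_cylinder v \<in> L2C.span (char_cylinder ` {w. length w = Suc (length v)})" .
qed

lemma H_cyl_mono: "m \<le> n \<Longrightarrow> H_cyl m \<subseteq> H_cyl n"
  by (rule lift_Suc_mono_le[of H_cyl, OF H_cyl_mono_Suc])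

lemma subspace_Union_H_cyl: "L2C.subspace (\<Union>n. H_cyl n)"
  unfolding L2C.subspace_def
proof (intro conjI ballI allI)
  fix f g assume "f \<in> (\<Union>n. H_cyl n)" "g \<in> (\<Union>n. H_cyl n)"
  then obtain m n where "f \<in> H_cyl m" "g \<in> H_cyl n" by blast
  then have "f \<in> H_cyl (max m n)" "g \<in> H_cyl (max m n)"
    using H_cyl_mono[of m "max m n"] H_cyl_mono[of n "max m n"] by auto
  then have "f + g \<in> H_cyl (max m n)" unfolding H_cyl_def by (rule L2C.span_add)
  then show "f + g \<in> (\<Union>n. H_cyl n)" by blast
next
  show "0 \<in> (\<Union>n. H_cyl n)" by (simp add: H_cyl_def L2C.span_zero)
  show "scaleC_L2 c f \<in> (\<Union>n. H_cyl n)" if "f \<in> (\<Union>n. H_cyl n)" for c f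
    using that L2C.span_scale unfolding H_cyl_def by blast
qed

lemma subspace_closure_L2:
  assumes "L2C.subspace V"
  shows "L2C.subspace (closure V)"
  unfolding L2C.subspace_def
proof (intro conjI ballI allI)
  show "0 \<in> closure V" using L2C.subspace_0[OF assms] closure_subset by blast
next
  fix f g assume "f \<in> closure V" "g \<in> closure V"
  then obtain s t where "\<And>n. s n \<in> V" "s \<longlonglongrightarrow> f" "\<And>n. t n \<in> V" "t \<longlonglongrightarrow> g"
    unfolding closure_sequential by blast
  then show "f + g \<in> closure V"
    unfolding closure_sequential
    by (intro exI[of _ "\<lambda>n. s n + t n"]) (auto intro: tendsto_add L2C.subspace_add[OF assms])
next
  fix c :: complex and f assume "f \<in> closure V"
  then obtain s where s: "\<And>n. s n \<in> V" "s \<longlonglongrightarrow> f" unfolding closure_sequential by blast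
  have "(\<lambda>n. norm c * norm (s n - f)) \<longlonglongrightarrow> norm c * 0"
    using s(2) by (intro tendsto_mult_left tendsto_norm_zero) (simp add: LIM_zero)
  then have "(\<lambda>n. norm (scaleC_L2 c (s n) - scaleC_L2 c f)) \<longlonglongrightarrow> 0"
    by (simp add: L2C.scale_right_diff_distrib[symmetric] norm_scaleC_L2)
  then have "(\<lambda>n. scaleC_L2 c (s n)) \<longlonglongrightarrow> scaleC_L2 c f"
    by (simp add: LIM_zero_iff tendsto_norm_zero_iff)
  then show "scaleC_L2 c f \<in> closure V"
    unfolding closure_sequential
    by (intro exI[of _ "\<lambda>n. scaleC_L2 c (s n)"]) (auto intro: s L2C.subspace_scale[OF assms])
qed

lemma sets_bernoulli_sigma: "sets bernoulli = sigma_sets UNIV (range cylinder \<union> {{}})"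
proof -
  have "cylinder = sstart UNIV" by (rule ext) (rule cylinder_eq_sstart)
  then show ?thesis
    unfolding sets_bernoulli by (subst sets_stream_space_sstart) simp_all
qed

text \<open>Dynkin's argument: cylinders and the empty set form an intersection-stable generator,
  complements stay inside because the closure is a subspace, and disjoint unions by dominated
  convergence.\<close>

lemma indicator_in_closure_H_cyl:
  assumes "A \<in> sets bernoulli"
  shows "abs_L2 (indicator A) \<in> closure (\<Union>n. H_cyl n)" (is "_ \<in> ?V")
proof -
  note sub = subspace_closure_L2[OF subspace_Union_H_cyl]
  have cyl: "abs_L2 (indicator (cylinder v)) \<in> ?V" for v
  proof -
    have "char_cylinder v \<in> H_cyl (length v)"
      unfolding H_cyl_def by (intro L2C.span_base) simp
    then show ?thesis
      using closure_subset[of "\<Union>n. H_cyl n"] unfolding char_cylinder.abs_eq by blast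
  qed
  have emp: "abs_L2 (indicator {}) \<in> ?V"
  proof -
    have "indicator {} = (\<lambda>_ :: bool stream. 0 :: complex)" by (rule ext) simp
    then show ?thesis using L2C.subspace_0[OF sub] by (simp only: zero_L2_def)
  qed
  have UNIV: "abs_L2 (indicator UNIV) \<in> ?V"
    using cyl[of "[]"] by (simp add: cylinder_def)
  have "cylinder = sstart UNIV" by (rule ext) (rule cylinder_eq_sstart)
  then have "Int_stable (range cylinder \<union> {{}})"
    using Int_stable_sstart[of "UNIV :: bool set"] by simp
  moreover have "range cylinder \<union> {{}} \<subseteq> Pow UNIV" by simp
  moreover have "A \<in> sigma_sets UNIV (range cylinder \<union> {{}})"
    using assms by (simp add: sets_bernoulli_sigma)
  ultimately show ?thesis
  proof (induction rule: sigma_sets_induct_disjoint)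
    case (basic A)
    then consider "A = {}" | v where "A = cylinder v" by blast
    then show ?case using cyl emp by cases (simp_all only:)
  next
    case empty
    show ?case by (rule emp)
  next
    case (compl A)
    then have A: "A \<in> sets bernoulli" by (simp add: sets_bernoulli_sigma)
    have "abs_L2 (indicator UNIV) - abs_L2 (indicator A) = abs_L2 (\<lambda>x. indicator UNIV x - indicator A x)"
      by (intro abs_L2_simps sq_integrable_indicator A) (simp add: sets_bernoulli_sigma sigma_sets_top)
    also have "(\<lambda>x. indicator UNIV x - indicator A x :: complex) = indicator (UNIV - A)"
      by (auto simp: indicator_def)
    finally show ?case using L2C.subspace_diff[OF sub UNIV compl.IH] by simp
  next
    case (union A)
    then have A: "A i \<in> sets bernoulli" for i by (auto simp: sets_bernoulli_sigma)
    let ?s = "\<lambda>n x. indicator (\<Union>i<n. A i) x :: complex"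
    have "abs_L2 (?s n) \<in> ?V" for n
    proof (induction n)
      case 0
      show ?case using L2C.subspace_0[OF sub] by (simp add: zero_L2_def)
    next
      case (Suc n)
      have "?s (Suc n) x = ?s n x + indicator (A n) x" for x
      proof -
        have "A i \<inter> A n = {}" if "i < n" for i
          using disjoint_family_onD[OF \<open>disjoint_family A\<close>, of i n] that by simp
        then have "(\<Union>i<n. A i) \<inter> A n = {}" by blast
        then show ?thesis
          unfolding lessThan_Suc UN_insert Un_commute[of "A n"] by (rule indicator_add[symmetric])
      qed
      then have "?s (Suc n) = (\<lambda>x. ?s n x + indicator (A n) x)" by (rule ext)
      moreover have "sq_integrable (?s n)" "sq_integrable (indicator (A n))"
        using A by (auto intro!: sq_integrable_indicator)
      ultimately have "abs_L2 (?s (Suc n)) = abs_L2 (?s n) + abs_L2 (indicator (A n))"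
        by (simp only: abs_L2_simps(1))
      then show ?case using L2C.subspace_add[OF sub Suc union(3)] by simp
    qed
    moreover have "(\<lambda>n. abs_L2 (?s n)) \<longlonglongrightarrow> abs_L2 (indicator (\<Union>i. A i))"
    proof (rule L2_dominated_convergence(3))
      show "sq_integrable (indicator (\<Union>i. A i))" using A by (intro sq_integrable_indicator) auto
      show "?s n \<in> borel_measurable bernoulli" for n using A by measurable
      show "(\<lambda>n. ?s n x) \<longlonglongrightarrow> indicator (\<Union>i. A i) x" for x by (rule LIMSEQ_indicator_UN)
      show "norm (?s n x) \<le> 1 * norm (indicator (\<Union>i. A i) x :: complex)" for n x
        by (auto simp: indicator_def)
    qed
    ultimately show ?case by (rule closed_sequentially[OF closed_closure])
  qed
qed

lemma closure_Union_H_cyl: "closure (\<Union>n. H_cyl n) = UNIV"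
proof -
  let ?V = "closure (\<Union>n. H_cyl n)"
  note sub = subspace_closure_L2[OF subspace_Union_H_cyl]
  have "F \<in> ?V" for F
  proof -
    obtain f where f: "sq_integrable f" and F: "F = abs_L2 f" by (rule L2_cases)
    then have meas: "f \<in> borel_measurable bernoulli" by (simp add: sq_integrable_def)
    \<comment> \<open>Simple functions approximating \<open>f\<close> relative to the point 0; the
      resulting bound 2 |f| is the domination used below.\<close>
    obtain s where s: "\<And>i. simple_function bernoulli (s i)" "\<And>x. (\<lambda>i. s i x) \<longlonglongrightarrow> f x"
      "\<And>i x. norm (s i x) \<le> 2 * norm (f x)"
      using borel_measurable_implies_sequence_metric[OF meas, of 0]
      unfolding dist_norm diff_0_right space_bernoulli by blast
    have "abs_L2 (s i) \<in> ?V" for i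
    proof -
      let ?R = "s i ` UNIV"
      let ?t = "\<lambda>y x. y * indicator (s i -` {y}) x"
      have fin: "finite ?R" using simple_functionD(1)[OF s(1), of i] by simp
      have sets: "s i -` {y} \<in> sets bernoulli" for y
        using simple_functionD(2)[OF s(1)[of i], of "{y}"] by simp
      have "sq_integrable (\<lambda>x. \<Sum>y\<in>S. ?t y x) \<and> abs_L2 (\<lambda>x. \<Sum>y\<in>S. ?t y x) \<in> ?V"
        if "finite S" for S
        using that
      proof induction
        case empty
        then show ?case
          using L2C.subspace_0[OF sub] by (simp add: zero_L2_def sq_integrable_zero)
      next
        case (insert y S)
        have ty: "sq_integrable (?t y)" by (intro sq_integrable_cmult sq_integrable_indicator sets)
        have "abs_L2 (?t y) = scaleC_L2 y (abs_L2 (indicator (s i -` {y})))"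
          by (simp only: abs_L2_simps(2)[OF sq_integrable_indicator sq_integrable_zero] sets)
        then have "abs_L2 (?t y) \<in> ?V"
          using L2C.subspace_scale[OF sub indicator_in_closure_H_cyl[OF sets]] by simp
        then have "abs_L2 (\<lambda>x. ?t y x + (\<Sum>y\<in>S. ?t y x)) \<in> ?V"
          using L2C.subspace_add[OF sub] insert.IH by (simp add: abs_L2_simps(1)[OF ty, symmetric])
        moreover have "sq_integrable (\<lambda>x. ?t y x + (\<Sum>y\<in>S. ?t y x))"
          using sq_integrable_add[OF ty] insert.IH by blast
        ultimately show ?case unfolding sum.insert[OF insert.hyps] by blast
      qed
      from this[OF fin] have "abs_L2 (\<lambda>x. \<Sum>y\<in>?R. ?t y x) \<in> ?V" by simp
      moreover have "s i x = (\<Sum>y\<in>?R. ?t y x)" for x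
      proof -
        have "(\<Sum>y\<in>?R. ?t y x) = (\<Sum>y\<in>?R. if y = s i x then y else 0)"
          by (intro sum.cong) (auto simp: indicator_def)
        also have "\<dots> = s i x" using fin by (subst sum.delta) auto
        finally show ?thesis by simp
      qed
      then have "s i = (\<lambda>x. \<Sum>y\<in>?R. ?t y x)" by (rule ext)
      ultimately show ?thesis by simp
    qed
    moreover have "(\<lambda>i. abs_L2 (s i)) \<longlonglongrightarrow> F"
      unfolding F using s
      by (intro L2_dominated_convergence(3)[OF f, where c = 2]) (simp_all add: borel_measurable_simple_function)
    ultimately show ?thesis by (rule closed_sequentially[OF closed_closure])
  qed
  then show ?thesis by blast
qed

text \<open>
  Riesz--Fischer: a Cauchy sequence has a subsequence \<open>f k\<close> whose increments \<open>d k\<close> satisfy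
  \<open>\<parallel>d k\<parallel>\<^sup>2 \<le> 8\<^sup>-\<^sup>k\<close>; as \<open>\<bar>d k\<bar> \<le> 2\<^sup>-\<^sup>k + 2\<^sup>k \<bar>d k\<bar>\<^sup>2\<close> pointwise, the increments are summable almost
  everywhere, and Fatou's lemma identifies the pointwise limit as the limit in norm.
\<close>

instance L2 :: complete_space
proof
  fix X :: "nat \<Rightarrow> L2"
  assume "Cauchy X"
  interpret prob_space bernoulli by (rule prob_space_bernoulli)
  \<comment> \<open>Squared norms of at most 8^-k leave the summable 4^-k after multiplication by
    the weight 2^k.\<close>
  define e :: "nat \<Rightarrow> real" where "e k = sqrt ((1 / 8) ^ k)" for k
  have e_pos: "e k > 0" for k by (simp add: e_def)
  have e_lim: "e \<longlonglongrightarrow> 0"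
    unfolding e_def using tendsto_real_sqrt[OF LIMSEQ_realpow_zero[of "1 / 8"]] by simp
  have "\<exists>N. \<forall>m\<ge>N. \<forall>n\<ge>N. norm (X m - X n) < e k" for k
    using CauchyD[OF \<open>Cauchy X\<close> e_pos] .
  then obtain N where N: "\<And>k m n. m \<ge> N k \<Longrightarrow> n \<ge> N k \<Longrightarrow> norm (X m - X n) < e k" by metis
  \<comment> \<open>Summing the thresholds makes \<open>r j\<close> at least \<open>N k\<close> for
    all k up to j at once.\<close>
  define r where "r k = (\<Sum>j\<le>k. N j) + k" for k
  have r_N: "N k \<le> r j" if "k \<le> j" for k j
    unfolding r_def using member_le_sum[of k "{..j}" N] that by simp
  have cauchy: "norm (X (r i) - X (r j)) < e k" if "k \<le> i" "k \<le> j" for i j k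
    by (intro N r_N that)
  have "\<exists>f. sq_integrable f \<and> X n = abs_L2 f" for n by (metis L2_cases)
  then obtain f' where "\<And>n. sq_integrable (f' n) \<and> X n = abs_L2 (f' n)" by metis
  then obtain f where f: "\<And>k. sq_integrable (f k)" and Xf: "\<And>k. X (r k) = abs_L2 (f k)"
    by (metis comp_apply)
  have [measurable]: "f k \<in> borel_measurable bernoulli" for k
    using f[of k] by (simp add: sq_integrable_def)
  have dist: "(\<integral>\<^sup>+x. ennreal ((norm (f i x - f j x))\<^sup>2) \<partial>bernoulli) \<le> ennreal ((e k)\<^sup>2)"
    if "k \<le> i" "k \<le> j" for i j k
  proof -
    note ij = sq_integrable_diff[OF f[of i] f[of j]]
    have "(\<integral>\<^sup>+x. ennreal ((norm (f i x - f j x))\<^sup>2) \<partial>bernoulli) =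
        ennreal (LINT x|bernoulli. (norm (f i x - f j x))\<^sup>2)"
      using ij by (intro nn_integral_eq_integral) (auto simp: sq_integrable_def)
    also have "(LINT x|bernoulli. (norm (f i x - f j x))\<^sup>2) = (norm (X (r i) - X (r j)))\<^sup>2"
      by (simp add: Xf abs_L2_simps(3)[OF f f] norm_abs_L2[OF ij])
    also have "\<dots> \<le> (e k)\<^sup>2"
      using cauchy[OF that] by (intro power_mono) auto
    finally show ?thesis by (simp add: ennreal_leI)
  qed
  let ?d = "\<lambda>k x. norm (f (Suc k) x - f k x)"
  have "(\<integral>\<^sup>+x. ennreal (2 ^ k * (?d k x)\<^sup>2) \<partial>bernoulli) \<le> ennreal ((1 / 4) ^ k)" for k
  proof -
    have "(\<integral>\<^sup>+x. ennreal (2 ^ k * (?d k x)\<^sup>2) \<partial>bernoulli) =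
        ennreal (2 ^ k) * (\<integral>\<^sup>+x. ennreal ((?d k x)\<^sup>2) \<partial>bernoulli)"
      by (subst nn_integral_cmult[symmetric]) (simp_all add: ennreal_mult)
    also have "\<dots> \<le> ennreal (2 ^ k) * ennreal ((e k)\<^sup>2)"
      by (intro mult_left_mono dist) auto
    also have "\<dots> = ennreal ((1 / 4) ^ k)"
      by (simp add: e_def ennreal_mult[symmetric] power_mult_distrib[symmetric])
    finally show ?thesis .
  qed
  then have "(\<integral>\<^sup>+x. (\<Sum>k. ennreal (2 ^ k * (?d k x)\<^sup>2)) \<partial>bernoulli) \<le> (\<Sum>k. ennreal ((1 / 4) ^ k))"
    by (subst nn_integral_suminf) (auto intro!: suminf_le)
  also have "\<dots> = ennreal (\<Sum>k. (1 / 4) ^ k)"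
    by (intro suminf_ennreal2 summable_geometric) auto
  also have "\<dots> < \<infinity>" by simp
  finally have "(\<integral>\<^sup>+x. (\<Sum>k. ennreal (2 ^ k * (?d k x)\<^sup>2)) \<partial>bernoulli) \<noteq> \<infinity>" by simp
  then have "AE x in bernoulli. (\<Sum>k. ennreal (2 ^ k * (?d k x)\<^sup>2)) \<noteq> \<infinity>"
    by (intro nn_integral_PInf_AE) measurable
  moreover have "convergent (\<lambda>k. f k x)" if fin: "(\<Sum>k. ennreal (2 ^ k * (?d k x)\<^sup>2)) \<noteq> \<infinity>" for x
  proof -
    have "summable (\<lambda>k. 2 ^ k * (?d k x)\<^sup>2)"
      using fin by (intro summable_suminf_not_top) auto
    then have sum: "summable (\<lambda>k. (1 / 2) ^ k + 2 ^ k * (?d k x)\<^sup>2)"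
      by (intro summable_add summable_geometric) auto
    have "?d k x \<le> (1 / 2) ^ k + 2 ^ k * (?d k x)\<^sup>2" for k
    proof (cases "?d k x \<le> (1 / 2) ^ k")
      case True
      then show ?thesis by (meson add_increasing2 zero_le_mult_iff zero_le_power zero_le_power2 zero_le_numeral)
    next
      case False
      then have "1 \<le> 2 ^ k * ?d k x" by (simp add: power_one_over field_simps)
      then have "1 * ?d k x \<le> (2 ^ k * ?d k x) * ?d k x" by (intro mult_right_mono) auto
      then have "?d k x \<le> 2 ^ k * (?d k x)\<^sup>2" by (simp add: power2_eq_square mult.assoc)
      then show ?thesis by (rule order_trans) simp
    qed
    then have "summable (\<lambda>k. f (Suc k) x - f k x)"
      by (intro summable_norm_cancel[OF summable_comparison_test[OF _ sum]]) auto
    then have "convergent (\<lambda>n. \<Sum>k<n. f (Suc k) x - f k x)"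
      by (simp add: summable_iff_convergent)
    then have "convergent (\<lambda>n. f n x - f 0 x)"
      by (simp only: sum_lessThan_telescope[of "\<lambda>k. f k x"])
    then have "convergent (\<lambda>n. (f n x - f 0 x) + f 0 x)"
      by (intro convergent_add convergent_const)
    then show ?thesis by simp
  qed
  ultimately have conv: "AE x in bernoulli. (\<lambda>k. f k x) \<longlonglongrightarrow> lim (\<lambda>k. f k x)"
    unfolding convergent_LIMSEQ_iff by (auto elim: AE_mp)
  \<comment> \<open>On the null set where the sequence diverges \<open>lim\<close> is an unspecified
    value; the function is measurable all the same.\<close>
  define F where "F x = lim (\<lambda>k. f k x)" for x
  have F_meas [measurable]: "F \<in> borel_measurable bernoulli"
    unfolding F_def by measurable
  have fatou: "(\<integral>\<^sup>+x. ennreal ((norm (F x - f k x))\<^sup>2) \<partial>bernoulli) \<le> ennreal ((e k)\<^sup>2)" for k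
  proof -
    have "AE x in bernoulli. ennreal ((norm (F x - f k x))\<^sup>2) =
        liminf (\<lambda>j. ennreal ((norm (f j x - f k x))\<^sup>2))"
      using conv
    proof eventually_elim
      case (elim x)
      then have "(\<lambda>j. ennreal ((norm (f j x - f k x))\<^sup>2)) \<longlonglongrightarrow> ennreal ((norm (F x - f k x))\<^sup>2)"
        unfolding F_def by (intro tendsto_intros tendsto_ennrealI)
      then show ?case by (rule lim_imp_Liminf[OF sequentially_bot, symmetric])
    qed
    then have "(\<integral>\<^sup>+x. ennreal ((norm (F x - f k x))\<^sup>2) \<partial>bernoulli) =
        (\<integral>\<^sup>+x. liminf (\<lambda>j. ennreal ((norm (f j x - f k x))\<^sup>2)) \<partial>bernoulli)"
      by (rule nn_integral_cong_AE)
    also have "\<dots> \<le> liminf (\<lambda>j. \<integral>\<^sup>+x. ennreal ((norm (f j x - f k x))\<^sup>2) \<partial>bernoulli)"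
      by (rule nn_integral_liminf) measurable
    also have "\<dots> \<le> liminf (\<lambda>j. ennreal ((e k)\<^sup>2))"
      by (rule Liminf_mono) (auto intro!: eventually_sequentiallyI[of k] dist)
    also have "\<dots> = ennreal ((e k)\<^sup>2)" by (simp add: Liminf_const)
    finally show ?thesis .
  qed
  have diff: "sq_integrable (\<lambda>x. F x - f k x)" for k
    unfolding sq_integrable_def using fatou[of k]
    by (auto intro!: integrableI_nonneg simp: le_less_trans[OF _ ennreal_less_top])
  have F: "sq_integrable F"
    using sq_integrable_add[OF diff[of 0] f[of 0]] by simp
  have "norm (abs_L2 F - X (r k)) \<le> e k" for k
  proof -
    have "ennreal ((norm (abs_L2 F - X (r k)))\<^sup>2) = (\<integral>\<^sup>+x. ennreal ((norm (F x - f k x))\<^sup>2) \<partial>bernoulli)"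
      using diff[of k] unfolding Xf abs_L2_simps(3)[OF F f] norm_abs_L2[OF diff]
      by (intro nn_integral_eq_integral[symmetric]) (auto simp: sq_integrable_def)
    also note fatou[of k]
    finally have "(norm (abs_L2 F - X (r k)))\<^sup>2 \<le> (e k)\<^sup>2" by (subst (asm) ennreal_le_iff) simp_all
    then show ?thesis using e_pos[of k] by (simp add: power2_le_iff_abs_le)
  qed
  moreover have "norm (X (r k) - X n) < e k" if "n \<ge> r k" for k n
    by (intro N r_N) (use r_N[of k k] that in auto)
  \<comment> \<open>One \<open>e k\<close> for the distance from \<open>X (r k)\<close> to the
    limit, one for the distance to any later term.\<close>
  ultimately have near: "norm (X n - abs_L2 F) \<le> 2 * e k" if "n \<ge> r k" for k n
    using norm_triangle_ineq4[of "X n - X (r k)" "abs_L2 F - X (r k)"] that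
    by (smt (verit, ccfv_threshold) diff_diff_eq2 diff_add_cancel norm_minus_commute)
  have "X \<longlonglongrightarrow> abs_L2 F"
  proof (rule LIMSEQ_I)
    fix \<epsilon> :: real assume "\<epsilon> > 0"
    then have "\<forall>\<^sub>F k in sequentially. e k < \<epsilon> / 2"
      using order_tendstoD(2)[OF e_lim, of "\<epsilon> / 2"] by simp
    then obtain k where "e k < \<epsilon> / 2" by (auto simp: eventually_sequentially)
    then show "\<exists>n0. \<forall>n\<ge>n0. norm (X n - abs_L2 F) < \<epsilon>"
      using near by (intro exI[of _ "r k"] allI impI) (smt (verit) field_sum_of_halves)
  qed
  then show "convergent X" by (rule convergentI)
qed

section \<open>The finite levels\<close>

lemma koopman_fun_scaleC: "koopman_fun g (scaleC_L2 c f) = scaleC_L2 c (koopman_fun g f)"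
proof transfer
  fix g c f assume f: "L2_rel f f"
  have rel: "L2_rel u u \<Longrightarrow> L2_rel (\<lambda>x. u (app_bdry (inv\<^bsub>Aut_tree\<^esub> g) x)) (\<lambda>x. u (app_bdry (inv\<^bsub>Aut_tree\<^esub> g) x))" for u
    using koopman_fun.rsp unfolding rel_fun_def by blast
  have "L2_rel (\<lambda>x. c * f x) (\<lambda>x. c * f x)"
    using f by (auto simp: L2_rel_def sq_integrable_cmult)
  from rel[OF this] show "L2_rel (\<lambda>x. c * f (app_bdry (inv\<^bsub>Aut_tree\<^esub> g) x)) (\<lambda>x. c * f (app_bdry (inv\<^bsub>Aut_tree\<^esub> g) x))" .
qed

lemma inv_gens [simp]:
  "inv\<^bsub>Aut_tree\<^esub> gen_a = gen_a" "inv\<^bsub>Aut_tree\<^esub> gen_b = gen_b" "inv\<^bsub>Aut_tree\<^esub> gen_c = gen_c"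
  by (rule group.inv_equality[OF group_Aut_tree];
      auto simp: Aut_tree_def tree_mult.rep_eq tree_one.rep_eq gen_a.rep_eq gen_b.rep_eq gen_c.rep_eq
        word_a_invol word_bc_invol intro!: tree_aut_eqI)+

lemma stake_eqI:
  assumes "\<And>n. stake n x = stake n y"
  shows "x = y"
proof -
  have "x !! n = y !! n" for n
    using assms[of "Suc n"] by (metis stake_nth lessI)
  then have "snth x = snth y" by (rule ext)
  then show ?thesis by (metis stream_smap_nats)
qed

lemma app_bdry_invol:
  assumes "\<And>w. app_word g (app_word g w) = w"
  shows "app_bdry g (app_bdry g x) = x"
  by (rule stake_eqI) (simp add: stake_app_bdry assms)

lemma koopman_fun_char_cylinder:
  assumes "inv\<^bsub>Aut_tree\<^esub> g = g" "\<And>w. app_word g (app_word g w) = w"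
  shows "koopman_fun g (char_cylinder v) = char_cylinder (app_word g v)"
proof -
  have "stake (length v) (app_bdry g x) = v \<longleftrightarrow> stake (length v) x = app_word g v" for x
    unfolding stake_app_bdry using assms(2) by metis
  then have eq: "indicator (cylinder v) (app_bdry g x) = (indicator (cylinder (app_word g v)) x :: complex)" for x
    by (auto simp: cylinder_def indicator_def)
  show ?thesis
    unfolding char_cylinder.abs_eq
    by (simp add: koopman_fun.abs_eq L2_rel_def sq_integrable_indicator assms(1) eq)
qed

lemma koopman_fun_invol:
  assumes "inv\<^bsub>Aut_tree\<^esub> g = g" "\<And>w. app_word g (app_word g w) = w"
  shows "koopman_fun g (koopman_fun g f) = f"
proof -
  have "koopman_fun h (koopman_fun h' f) = f"
    if "\<And>x. app_bdry (inv\<^bsub>Aut_tree\<^esub> h') (app_bdry (inv\<^bsub>Aut_tree\<^esub> h) x) = x" for h h'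
    using that by transfer simp
  then show ?thesis using assms by (simp add: app_bdry_invol)
qed

lemma app_word_gens_invol:
  "app_word gen_a (app_word gen_a w) = w" "app_word gen_b (app_word gen_b w) = w"
  "app_word gen_c (app_word gen_c w) = w"
  by (simp_all add: gen_a.rep_eq gen_b.rep_eq gen_c.rep_eq word_a_invol word_bc_invol)

lemma Mop_apply:
  "blinfun_apply (Mop (y, z, l)) f = koopman_fun gen_a f + y *\<^sub>R koopman_fun gen_b f
    + z *\<^sub>R koopman_fun gen_c f - l *\<^sub>R f"
  by (simp add: Mop_def koopman.rep_eq blinfun.add_left blinfun.diff_left blinfun.scaleR_left)

text \<open>Each generator acts as an isometry that is its own inverse, hence symmetrically, and the
  coefficients are real.\<close>

lemma Mop_symmetric: "blinfun_apply (Mop p) f \<bullet> g = f \<bullet> blinfun_apply (Mop p) g"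
proof -
  have "koopman_fun h f \<bullet> g = f \<bullet> koopman_fun h g"
    if "inv\<^bsub>Aut_tree\<^esub> h = h" "\<And>w. app_word h (app_word h w) = w" for h
    using inner_koopman_fun[of h f "koopman_fun h g"] koopman_fun_invol[OF that] by simp
  note this[OF inv_gens(1) app_word_gens_invol(1)] this[OF inv_gens(2) app_word_gens_invol(2)]
    this[OF inv_gens(3) app_word_gens_invol(3)]
  then show ?thesis
    by (cases p) (simp add: Mop_apply inner_add_left inner_add_right inner_diff_left inner_diff_right)
qed

lemma scaleR_eq_scaleC: "r *\<^sub>R f = scaleC_L2 (of_real r) f" for f :: L2
  by transfer (auto simp: L2_rel_def scaleR_conv_of_real sq_integrable_cmult)

lemma koopman_fun_add: "koopman_fun g (f + h) = koopman_fun g f + koopman_fun g h"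
  by (rule linear_add[OF bounded_linear.linear[OF bounded_linear_koopman_fun]])

lemma linear_Mop: "Vector_Spaces.linear scaleC_L2 scaleC_L2 (blinfun_apply (Mop p))"
proof (cases p)
  case (fields y z l)
  show ?thesis
    unfolding Vector_Spaces.linear_iff
    by (auto simp: vector_space_scaleC_L2 fields Mop_apply koopman_fun_add koopman_fun_scaleC scaleR_eq_scaleC
        L2C.scale_right_distrib L2C.scale_right_diff_distrib mult.commute)
qed

section \<open>Coordinates in the cylinder spaces\<close>

definition cyl_sum :: "nat \<Rightarrow> (bool list \<Rightarrow> complex) \<Rightarrow> L2" where
  "cyl_sum n u = (\<Sum>v | length v = n. scaleC_L2 (u v) (char_cylinder v))"

lemma finite_words: "finite {v :: bool list. length v = n}"
  using finite_lists_length_eq[of "UNIV :: bool set" n] by simp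

lemma card_words: "card {v :: bool list. length v = n} = 2 ^ n"
  using card_lists_length_eq[of "UNIV :: bool set" n] by simp

lemma inner_char_cylinder:
  assumes "length v = length w"
  shows "scaleC_L2 c (char_cylinder v) \<bullet> scaleC_L2 d (char_cylinder w) =
    (if v = w then (c \<bullet> d) / 2 ^ length v else 0)"
proof -
  interpret prob_space bernoulli by (rule prob_space_bernoulli)
  have ind: "(c * indicator (cylinder v) x) \<bullet> (d * indicator (cylinder w) x) =
      (if v = w then (c \<bullet> d) * indicator (cylinder v) x else 0)" for x
    using assms by (auto simp: indicator_def cylinder_def)
  have "measure bernoulli (cylinder v) = 1 / 2 ^ length v" for v
    by (simp add: measure_def emeasure_cylinder power_one_over)
  moreover have "scaleC_L2 c (char_cylinder v) \<bullet> scaleC_L2 d (char_cylinder w) =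
      (LINT x|bernoulli. (c * indicator (cylinder v) x) \<bullet> (d * indicator (cylinder w) x))"
    by transfer simp
  ultimately show ?thesis
    unfolding ind by simp
qed

lemma norm_cyl_sum: "(norm (cyl_sum n u))\<^sup>2 = (\<Sum>v | length v = n. (norm (u v))\<^sup>2) / 2 ^ n"
proof -
  have "(norm (cyl_sum n u))\<^sup>2 = (\<Sum>v | length v = n. \<Sum>w | length w = n.
      scaleC_L2 (u v) (char_cylinder v) \<bullet> scaleC_L2 (u w) (char_cylinder w))"
    by (simp add: cyl_sum_def power2_norm_eq_inner inner_sum_left inner_sum_right) (rule sum.swap)
  also have "\<dots> = (\<Sum>v | length v = n. \<Sum>w | length w = n.
      if w = v then (u v \<bullet> u v) / 2 ^ n else 0)"
    by (intro sum.cong refl) (auto simp: inner_char_cylinder)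
  also have "\<dots> = (\<Sum>v | length v = n. (norm (u v))\<^sup>2 / 2 ^ n)"
    by (intro sum.cong refl) (simp add: sum.delta[OF finite_words] power2_norm_eq_inner)
  finally show ?thesis by (simp add: sum_divide_distrib)
qed

text \<open>By orthogonality of the cylinders the norm is a weighted sum of squared coefficients, so
  the characteristic functions are linearly independent.\<close>

lemma cyl_sum_eq_0_iff: "cyl_sum n u = 0 \<longleftrightarrow> (\<forall>v. length v = n \<longrightarrow> u v = 0)"
proof -
  have "cyl_sum n u = 0 \<longleftrightarrow> (norm (cyl_sum n u))\<^sup>2 = 0" by simp
  also have "\<dots> \<longleftrightarrow> (\<forall>v. length v = n \<longrightarrow> u v = 0)"
    unfolding norm_cyl_sum by (simp add: sum_nonneg_eq_0_iff finite_words)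
  finally show ?thesis .
qed

lemma H_cyl_eq: "H_cyl n = range (cyl_sum n)"
proof
  show "H_cyl n \<subseteq> range (cyl_sum n)"
    unfolding H_cyl_def
  proof (rule L2C.span_minimal)
    show "char_cylinder ` {v. length v = n} \<subseteq> range (cyl_sum n)"
    proof clarify
      fix v :: "bool list" assume "n = length v"
      then have "cyl_sum n (\<lambda>w. if w = v then 1 else 0) = char_cylinder v"
        by (simp add: cyl_sum_def if_distrib[of "\<lambda>c. scaleC_L2 c _"] sum.delta[OF finite_words] cong: if_cong)
      then show "char_cylinder v \<in> range (cyl_sum (length v))" using \<open>n = length v\<close> by (metis rangeI)
    qed
    have "0 = cyl_sum n (\<lambda>_. 0)" by (simp add: cyl_sum_def)
    moreover have "cyl_sum n u + cyl_sum n u' = cyl_sum n (\<lambda>v. u v + u' v)" for u u'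
      by (simp add: cyl_sum_def L2C.scale_left_distrib sum.distrib)
    moreover have "scaleC_L2 c (cyl_sum n u) = cyl_sum n (\<lambda>v. c * u v)" for c u
      by (simp add: cyl_sum_def L2C.scale_sum_right)
    ultimately show "L2C.subspace (range (cyl_sum n))"
      unfolding L2C.subspace_def by auto
  qed
  show "range (cyl_sum n) \<subseteq> H_cyl n"
    unfolding H_cyl_def cyl_sum_def
    by (auto intro!: L2C.span_sum L2C.span_scale intro: L2C.span_base)
qed

lemma koopman_cyl_sum:
  assumes "inv\<^bsub>Aut_tree\<^esub> g = g" "\<And>w. app_word g (app_word g w) = w"
  shows "koopman_fun g (cyl_sum n u) = cyl_sum n (\<lambda>v. u (app_word g v))"
proof -
  interpret bounded_linear "koopman_fun g" by (rule bounded_linear_koopman_fun)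
  have "koopman_fun g (cyl_sum n u) =
      (\<Sum>v | length v = n. scaleC_L2 (u v) (char_cylinder (app_word g v)))"
    by (simp add: cyl_sum_def sum koopman_fun_scaleC koopman_fun_char_cylinder[OF assms])
  also have "\<dots> = cyl_sum n (\<lambda>v. u (app_word g v))"
    unfolding cyl_sum_def
    by (rule sum.reindex_bij_witness[where i = "app_word g" and j = "app_word g"]) (auto simp: assms(2))
  finally show ?thesis .
qed

lemma Mop_cyl_sum: "blinfun_apply (Mop p) (cyl_sum n u) = cyl_sum n (word_op p u)"
proof (cases p)
  case (fields y z l)
  show ?thesis
    unfolding fields Mop_apply koopman_cyl_sum[OF inv_gens(1) app_word_gens_invol(1)]
      koopman_cyl_sum[OF inv_gens(2) app_word_gens_invol(2)]
      koopman_cyl_sum[OF inv_gens(3) app_word_gens_invol(3)]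
    by (simp add: word_op_def cyl_sum_def scaleR_eq_scaleC
        L2C.scale_left_distrib L2C.scale_left_diff_distrib L2C.scale_sum_right sum.distrib sum_subtractf
        gen_a.rep_eq gen_b.rep_eq gen_c.rep_eq)
qed

lemma Mop_H_cyl: "f \<in> H_cyl n \<Longrightarrow> blinfun_apply (Mop p) f \<in> H_cyl n"
  by (auto simp: H_cyl_eq Mop_cyl_sum)

text \<open>Dimension count inside a possibly infinite-dimensional space: a basis C of the span of B
  is mapped to an independent set of the same size in that span, and a vector outside the span of
  the image would give card C + 1 independent vectors.\<close>

lemma (in vector_space) inj_on_span_imp_surj:
  assumes T: "Vector_Spaces.linear scale scale T" and "finite B" "T ` span B \<subseteq> span B"
    and inj: "inj_on T (span B)"
  shows "T ` span B = span B"
proof -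
  interpret T: Vector_Spaces.linear scale scale T by (rule T)
  obtain C where C: "C \<subseteq> B" "independent C" "B \<subseteq> span C"
    by (rule maximal_independent_subset)
  have fin: "finite C" using C \<open>finite B\<close> by (blast intro: finite_subset)
  have span: "span C = span B"
    using C span_mono[OF C(1)] span_minimal[OF C(3) subspace_span] by blast
  have ind: "independent (T ` C)"
    using T.independent_injective_image[OF C(2)] inj span by simp
  have sub: "T ` C \<subseteq> span C"
    using span_superset[of C] assms(3) unfolding span by blast
  have inj_C: "inj_on T C"
    using inj span span_superset[of C] by (blast intro: inj_on_subset)
  have "span C \<subseteq> span (T ` C)"
  proof
    fix x assume x: "x \<in> span C"
    show "x \<in> span (T ` C)"
    proof (rule ccontr)
      assume no: "x \<notin> span (T ` C)"
      have "insert x (T ` C) \<subseteq> span C" using x sub by simp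
      then have "card (insert x (T ` C)) \<le> card C"
        using independent_span_bound[OF fin independent_insertI[OF no ind]] by simp
      moreover have "x \<notin> T ` C" using no span_base[of x "T ` C"] by blast
      ultimately show False using fin by (simp add: card_image[OF inj_C])
    qed
  qed
  then have "span B \<subseteq> T ` span B" unfolding T.span_image span .
  with assms(3) show ?thesis by blast
qed

lemma bij_Mop_H_cyl_iff:
  "bij_betw (blinfun_apply (Mop p)) (H_cyl n) (H_cyl n) \<longleftrightarrow>
    (\<forall>f\<in>H_cyl n. blinfun_apply (Mop p) f = 0 \<longrightarrow> f = 0)"
proof
  have 0: "0 \<in> H_cyl n" unfolding H_cyl_def by (rule L2C.span_zero)
  show "\<forall>f\<in>H_cyl n. blinfun_apply (Mop p) f = 0 \<longrightarrow> f = 0"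
    if "bij_betw (blinfun_apply (Mop p)) (H_cyl n) (H_cyl n)"
    using bij_betw_imp_inj_on[OF that] 0 by (auto dest: inj_onD[where y = 0])
  assume *: "\<forall>f\<in>H_cyl n. blinfun_apply (Mop p) f = 0 \<longrightarrow> f = 0"
  have inj: "inj_on (blinfun_apply (Mop p)) (H_cyl n)"
  proof (rule inj_onI)
    fix f g assume fg: "f \<in> H_cyl n" "g \<in> H_cyl n" "blinfun_apply (Mop p) f = blinfun_apply (Mop p) g"
    then have "f - g \<in> H_cyl n" unfolding H_cyl_def by (simp add: L2C.span_diff)
    moreover have "blinfun_apply (Mop p) (f - g) = 0" using fg(3) by (simp add: blinfun.diff_right)
    ultimately have "f - g = 0" using * by blast
    then show "f = g" by simp
  qed
  have "blinfun_apply (Mop p) ` H_cyl n = H_cyl n"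
    using L2C.inj_on_span_imp_surj[OF linear_Mop, of "char_cylinder ` {v. length v = n}" p]
      inj Mop_H_cyl finite_words unfolding H_cyl_def by blast
  with inj show "bij_betw (blinfun_apply (Mop p)) (H_cyl n) (H_cyl n)" by (simp add: bij_betw_def)
qed

lemma sp_fin_eq_word_sp: "sp_fin n = word_sp n"
proof -
  have "p \<in> sp_fin n \<longleftrightarrow> p \<in> word_sp n" for p
    unfolding sp_fin_def word_sp_def mem_Collect_eq bij_Mop_H_cyl_iff
    by (auto simp: H_cyl_eq Mop_cyl_sum cyl_sum_eq_0_iff)
  then show ?thesis by blast
qed

section \<open>Spectrum and eigenvalues\<close>

text \<open>Balls of the infinite-dimensional \<open>L2\<close> are not compact, so compactness is
  drawn from the coefficients, adding the continuous image of one complex disc per vector.\<close>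

lemma compact_scaleC_sums:
  assumes "finite A"
  shows "compact {\<Sum>v\<in>A. scaleC_L2 (c v) (g v) |c. \<forall>v\<in>A. norm (c v) \<le> B}"
  using assms
proof induction
  case empty
  then show ?case by simp
next
  case (insert a A)
  let ?S = "\<lambda>A. {\<Sum>v\<in>A. scaleC_L2 (c v) (g v) |c. \<forall>v\<in>A. norm (c v) \<le> B}"
  have "bounded_linear (\<lambda>c. scaleC_L2 c (g a))"
    by (rule bounded_linear_intro[where K = "norm (g a)"])
      (simp_all add: L2C.scale_left_distrib scaleR_eq_scaleC norm_scaleC_L2 scaleR_conv_of_real)
  then have "compact ((\<lambda>c. scaleC_L2 c (g a)) ` cball 0 B)"
    by (intro compact_continuous_image linear_continuous_on compact_cball)
  then have "compact {x + y |x y. x \<in> (\<lambda>c. scaleC_L2 c (g a)) ` cball 0 B \<and> y \<in> ?S A}"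
    by (rule compact_sums) (rule insert.IH)
  also have "{x + y |x y. x \<in> (\<lambda>c. scaleC_L2 c (g a)) ` cball 0 B \<and> y \<in> ?S A} = ?S (insert a A)"
  proof (intro equalityI subsetI)
    fix f assume "f \<in> {x + y |x y. x \<in> (\<lambda>c. scaleC_L2 c (g a)) ` cball 0 B \<and> y \<in> ?S A}"
    then obtain d c where f: "f = scaleC_L2 d (g a) + (\<Sum>v\<in>A. scaleC_L2 (c v) (g v))"
      and "norm d \<le> B" "\<forall>v\<in>A. norm (c v) \<le> B" by (auto simp: dist_norm)
    moreover have "f = (\<Sum>v\<in>insert a A. scaleC_L2 ((c(a := d)) v) (g v))"
      unfolding f sum.insert[OF insert.hyps] using insert.hyps(2) by (auto intro!: sum.cong)
    ultimately show "f \<in> ?S (insert a A)"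
      by (intro CollectI exI[of _ "c(a := d)"]) auto
  next
    fix f assume "f \<in> ?S (insert a A)"
    then obtain c where f: "f = (\<Sum>v\<in>insert a A. scaleC_L2 (c v) (g v))"
      and "\<forall>v\<in>insert a A. norm (c v) \<le> B" by blast
    then have "scaleC_L2 (c a) (g a) \<in> (\<lambda>c. scaleC_L2 c (g a)) ` cball 0 B"
      "(\<Sum>v\<in>A. scaleC_L2 (c v) (g v)) \<in> ?S A" by (auto simp: dist_norm)
    moreover have "f = scaleC_L2 (c a) (g a) + (\<Sum>v\<in>A. scaleC_L2 (c v) (g v))"
      unfolding f sum.insert[OF insert.hyps] ..
    ultimately show "f \<in> {x + y |x y. x \<in> (\<lambda>c. scaleC_L2 c (g a)) ` cball 0 B \<and> y \<in> ?S A}"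
      by blast
  qed
  finally show ?case .
qed

text \<open>The squared coefficients of a unit vector sum to 2^n, so the sphere is a closed part of
  a compact set of combinations.\<close>

lemma compact_sphere_H_cyl: "compact {f \<in> H_cyl n. norm f = 1}"
proof -
  let ?K = "{\<Sum>v | length v = n. scaleC_L2 (c v) (char_cylinder v) |c. \<forall>v\<in>{v. length v = n}. norm (c v) \<le> 2 ^ n}"
  have "f \<in> ?K" if "f \<in> H_cyl n" "norm f = 1" for f
  proof -
    obtain u where u: "f = cyl_sum n u" using \<open>f \<in> H_cyl n\<close> by (auto simp: H_cyl_eq)
    then have sum: "(\<Sum>v | length v = n. (norm (u v))\<^sup>2) = 2 ^ n"
      using norm_cyl_sum[of n u] \<open>norm f = 1\<close> by (simp add: field_simps)
    have "norm (u v) \<le> 2 ^ n" if "length v = n" for v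
    proof -
      have "(norm (u v))\<^sup>2 \<le> 2 ^ n"
        using member_le_sum[of v "{v. length v = n}" "\<lambda>v. (norm (u v))\<^sup>2"] sum that finite_words by simp
      also have "\<dots> \<le> (2 ^ n)\<^sup>2" by (intro self_le_power) auto
      finally show ?thesis by (simp add: power2_le_iff_abs_le)
    qed
    then show ?thesis using u unfolding cyl_sum_def by blast
  qed
  moreover have "?K \<subseteq> H_cyl n" unfolding H_cyl_eq cyl_sum_def by blast
  ultimately have "{f \<in> H_cyl n. norm f = 1} = ?K \<inter> {f. norm f = 1}"
    by blast
  moreover have "closed {f :: L2. norm f = 1}"
    by (intro closed_Collect_eq continuous_intros)
  ultimately show ?thesis
    using compact_Int_closed[OF compact_scaleC_sums[OF finite_words]] by simp
qed

lemma subspace_H_cyl: "subspace (H_cyl n)"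
  unfolding subspace_def scaleR_eq_scaleC H_cyl_def
  by (simp add: L2C.span_zero L2C.span_add L2C.span_scale)

text \<open>
  If \<open>v\<close> minimises \<open>\<parallel>M v\<parallel>\<close> on the unit sphere, with minimum \<open>m\<close>, then \<open>v\<close> is a zero of a positive
  semidefinite form, so \<open>M\<^sup>2 v = m\<^sup>2 v\<close>; thus \<open>M v + m v\<close> or \<open>v\<close> is an eigenvector.
\<close>

lemma least_eigenvalue_Mop:
  obtains m v where "v \<in> H_cyl n" "v \<noteq> 0" "blinfun_apply (Mop p) v = m *\<^sub>R v"
    "\<And>w. w \<in> H_cyl n \<Longrightarrow> \<bar>m\<bar> * norm w \<le> norm (blinfun_apply (Mop p) w)"
proof -
  let ?M = "blinfun_apply (Mop p)"
  let ?S = "{f \<in> H_cyl n. norm f = 1}"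
  \<comment> \<open>The constant function 1 shows that the sphere is nonempty.\<close>
  define e where "e = cyl_sum n (\<lambda>_. 1)"
  have "(norm e)\<^sup>2 = 1" by (simp add: e_def norm_cyl_sum card_words)
  then have "norm e = 1" using norm_ge_zero[of e] by (simp add: power2_eq_1_iff)
  then have "e \<in> ?S" by (simp add: e_def H_cyl_eq)
  then obtain v where v: "v \<in> H_cyl n" "norm v = 1" and min: "\<And>w. w \<in> ?S \<Longrightarrow> norm (?M v) \<le> norm (?M w)"
  proof -
    have "continuous_on ?S (\<lambda>w. norm (?M w))" by (intro continuous_intros)
    then obtain v where "v \<in> ?S" "\<forall>w\<in>?S. norm (?M v) \<le> norm (?M w)"
      using continuous_attains_inf[OF compact_sphere_H_cyl, of n "\<lambda>w. norm (?M w)"] \<open>e \<in> ?S\<close> by blast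
    then show thesis using that by blast
  qed
  define m where "m = norm (?M v)"
  have bound: "m * norm w \<le> norm (?M w)" if "w \<in> H_cyl n" for w
  proof (cases "w = 0")
    case False
    then have "inverse (norm w) *\<^sub>R w \<in> ?S"
      using that subspace_scale[OF subspace_H_cyl] by simp
    from min[OF this] show ?thesis
      using False by (simp add: m_def blinfun.scaleR_right field_simps)
  qed simp
  \<comment> \<open>The form |M w|^2 - m^2 |w|^2 is nonnegative on \<open>H_cyl n\<close> and
    vanishes at v. Moving v by t r, along the gradient of the form, gives the value 2 t (r \<bullet>
    r) + t^2 q, negative for small negative t unless r = 0.\<close>
  define r where "r = ?M (?M v) - m\<^sup>2 *\<^sub>R v"
  have r: "r \<in> H_cyl n"
    unfolding r_def by (intro subspace_diff subspace_scale subspace_H_cyl Mop_H_cyl v)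
  have "r \<bullet> r = 0"
  proof (rule ccontr)
    assume nz: "r \<bullet> r \<noteq> 0"
    define q where "q = (norm (?M r))\<^sup>2 - m\<^sup>2 * (norm r)\<^sup>2"
    have ineq: "0 \<le> 2 * t * (r \<bullet> r) + t\<^sup>2 * q" for t
    proof -
      have "v + t *\<^sub>R r \<in> H_cyl n" by (intro subspace_add subspace_scale subspace_H_cyl v r)
      from power_mono[OF bound[OF this], of 2]
      have "m\<^sup>2 * (norm (v + t *\<^sub>R r))\<^sup>2 \<le> (norm (?M v + t *\<^sub>R ?M r))\<^sup>2"
        by (simp add: power_mult_distrib m_def blinfun.add_right blinfun.scaleR_right)
      moreover have "(norm (v + t *\<^sub>R r))\<^sup>2 = 1 + 2 * t * (v \<bullet> r) + t\<^sup>2 * (norm r)\<^sup>2"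
        using v(2) unfolding power2_norm_eq_inner norm_eq_1
        by (simp add: inner_add_left inner_add_right inner_commute[of r v] power2_eq_square algebra_simps)
      moreover have "(norm (?M v + t *\<^sub>R ?M r))\<^sup>2 = m\<^sup>2 + 2 * t * (?M v \<bullet> ?M r) + t\<^sup>2 * (norm (?M r))\<^sup>2"
        unfolding m_def power2_norm_eq_inner
        by (simp add: inner_add_left inner_add_right inner_commute[of "?M r" "?M v"] power2_eq_square algebra_simps)
      moreover have "?M v \<bullet> ?M r = r \<bullet> r + m\<^sup>2 * (v \<bullet> r)"
      proof -
        have "?M (?M v) = r + m\<^sup>2 *\<^sub>R v" by (simp add: r_def)
        with Mop_symmetric[of p "?M v" r] show ?thesis by (simp add: inner_add_left)
      qed
      ultimately show ?thesis
        by (simp add: q_def algebra_simps)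
    qed
    have "r \<bullet> r > 0" using nz inner_ge_zero[of r] by linarith
    \<comment> \<open>The value t = -1 shows q > 0; the minimiser t = -(r \<bullet> r) / q then
      gives the contradiction.\<close>
    moreover have "0 \<le> q - 2 * (r \<bullet> r)" using ineq[of "-1"] by simp
    ultimately have "q > 0" by linarith
    moreover have "0 \<le> 2 * (- (r \<bullet> r) / q) * (r \<bullet> r) + (- (r \<bullet> r) / q)\<^sup>2 * q" by (rule ineq)
    ultimately have "(r \<bullet> r)\<^sup>2 \<le> 0" by (simp add: power2_eq_square field_simps)
    with nz show False by simp
  qed
  then have M2: "?M (?M v) = m\<^sup>2 *\<^sub>R v" by (simp add: r_def)
  show thesis
  proof (cases "?M v + m *\<^sub>R v = 0")
    case True
    show thesis
      by (rule that[of v "- m"])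
        (use v True bound in \<open>auto simp: m_def eq_neg_iff_add_eq_0\<close>)
  next
    case False
    have eig: "?M (?M v + m *\<^sub>R v) = m *\<^sub>R (?M v + m *\<^sub>R v)"
      by (simp add: blinfun.add_right blinfun.scaleR_right M2 scaleR_add_right power2_eq_square add.commute)
    have mem: "?M v + m *\<^sub>R v \<in> H_cyl n"
      by (intro subspace_add subspace_scale subspace_H_cyl Mop_H_cyl v)
    show thesis
      by (rule that[OF mem False eig]) (use bound in \<open>auto simp: m_def\<close>)
  qed
qed

section \<open>Lower bounds and invertibility\<close>

lemma invertible_op_imp_bounded_below:
  assumes "invertible_op T"
  obtains e where "e > 0" "\<And>f. e * norm f \<le> norm (blinfun_apply T f)"
proof -
  obtain S where S: "S o\<^sub>L T = id_blinfun" using assms by (auto simp: invertible_op_def)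
  have "norm f \<le> (norm S + 1) * norm (blinfun_apply T f)" for f
  proof -
    have "f = blinfun_apply S (blinfun_apply T f)"
      using arg_cong[OF S, of "\<lambda>B. blinfun_apply B f"] by simp
    then have "norm f \<le> norm S * norm (blinfun_apply T f)" by (metis norm_blinfun)
    also have "\<dots> \<le> (norm S + 1) * norm (blinfun_apply T f)" by (simp add: algebra_simps)
    finally show ?thesis .
  qed
  moreover have "norm S + 1 > 0" by (simp add: add_nonneg_pos)
  ultimately show thesis
    by (intro that[of "1 / (norm S + 1)"]) (simp_all add: field_simps)
qed

text \<open>The lower bound makes the range complete, since \<open>L2\<close> is complete; hence the
  range is closed, and everything by density. The same bound gives the inverse norm at most 1 /
  e.\<close>

lemma invertible_opI_dense_range:
  assumes "e > 0" and bound: "\<And>f. e * norm f \<le> norm (blinfun_apply T f)"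
    and dense: "closure (range (blinfun_apply T)) = UNIV"
  shows "invertible_op T"
proof -
  have "uniform_space_class.complete (blinfun_apply T ` UNIV)"
    by (rule complete_isometric_image[OF \<open>e > 0\<close>])
      (auto simp: bound blinfun.bounded_linear_right complete_UNIV)
  then have surj: "surj (blinfun_apply T)"
    using dense by (simp add: complete_imp_closed closure_closed)
  have "inj (blinfun_apply T)"
  proof (rule injI)
    fix f g assume "blinfun_apply T f = blinfun_apply T g"
    then have "e * norm (f - g) \<le> 0" using bound[of "f - g"] by (simp add: blinfun.diff_right)
    then show "f = g" using \<open>e > 0\<close> by (simp add: mult_le_0_iff)
  qed
  define S where "S = inv_into UNIV (blinfun_apply T)"
  have TS: "blinfun_apply T (S f) = f" and ST: "S (blinfun_apply T f) = f" for f
    using surj \<open>inj _\<close> by (simp_all add: S_def surj_f_inv_f)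
  have "bounded_linear S"
  proof (rule bounded_linear_intro[where K = "1 / e"])
    show "S (f + g) = S f + S g" for f g by (metis ST TS blinfun.add_right)
    show "S (r *\<^sub>R f) = r *\<^sub>R S f" for r f by (metis ST TS blinfun.scaleR_right)
    show "norm (S f) \<le> norm f * (1 / e)" for f
      using bound[of "S f"] \<open>e > 0\<close> by (simp add: TS field_simps)
  qed
  then have "blinfun_apply (Blinfun S) = S" by (rule bounded_linear_Blinfun_apply)
  then have "Blinfun S o\<^sub>L T = id_blinfun" "T o\<^sub>L Blinfun S = id_blinfun"
    by (auto intro!: blinfun_eqI simp: ST TS)
  then show ?thesis unfolding invertible_op_def by blast
qed

text \<open>The lower bound passes to the closure by continuity. It also makes the operator
  injective, hence onto, on each \<open>H_cyl n\<close>, so the range contains their dense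
  union.\<close>

lemma invertible_MopI:
  assumes "e > 0" and bound: "\<And>n f. f \<in> H_cyl n \<Longrightarrow> e * norm f \<le> norm (blinfun_apply (Mop p) f)"
  shows "invertible_op (Mop p)"
proof (rule invertible_opI_dense_range[OF \<open>e > 0\<close>])
  let ?B = "{f. e * norm f \<le> norm (blinfun_apply (Mop p) f)}"
  have "closed ?B" by (intro closed_Collect_le continuous_intros)
  then have "closure (\<Union>n. H_cyl n) \<subseteq> ?B"
    using bound by (intro closure_minimal) auto
  then show "e * norm f \<le> norm (blinfun_apply (Mop p) f)" for f
    unfolding closure_Union_H_cyl by blast
  have "H_cyl n \<subseteq> range (blinfun_apply (Mop p))" for n
  proof -
    have "f = 0" if "f \<in> H_cyl n" "blinfun_apply (Mop p) f = 0" for f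
      using bound[OF that(1)] that(2) \<open>e > 0\<close> by (simp add: mult_le_0_iff)
    then have "bij_betw (blinfun_apply (Mop p)) (H_cyl n) (H_cyl n)"
      unfolding bij_Mop_H_cyl_iff by blast
    then show ?thesis by (auto simp: bij_betw_def)
  qed
  then show "closure (range (blinfun_apply (Mop p))) = UNIV"
    using closure_mono[of "\<Union>n. H_cyl n" "range (blinfun_apply (Mop p))"]
    unfolding closure_Union_H_cyl by blast
qed

text \<open>\<open>Mop\<close> is continuous in operator norm, and near a regular point half of its
  lower bound survives, which is enough for invertibility.\<close>

lemma closed_sp: "closed sp"
proof -
  have cont: "isCont Mop p" for p
  proof -
    have eq: "Mop = (\<lambda>p. koopman gen_a + fst p *\<^sub>R koopman gen_b + fst (snd p) *\<^sub>R koopman gen_c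
        - snd (snd p) *\<^sub>R id_blinfun)"
      by (auto simp: Mop_def)
    show ?thesis unfolding eq by (intro continuous_intros)
  qed
  have "\<exists>d>0. \<forall>q. dist q p < d \<longrightarrow> q \<in> - sp" if p: "p \<in> - sp" for p
  proof -
    from p have "invertible_op (Mop p)" by (simp add: sp_def)
    then obtain e where e: "e > 0" "\<And>f. e * norm f \<le> norm (blinfun_apply (Mop p) f)"
      by (rule invertible_op_imp_bounded_below) blast
    obtain d where d: "d > 0" "\<And>q. dist q p < d \<Longrightarrow> dist (Mop q) (Mop p) < e / 2"
      using cont[of p] \<open>e > 0\<close> unfolding continuous_at_eps_delta
      by (metis half_gt_zero)
    have "invertible_op (Mop q)" if "dist q p < d" for q
    proof (rule invertible_MopI[of "e / 2"])
      fix f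
      have "norm (blinfun_apply (Mop q - Mop p) f) \<le> norm (Mop q - Mop p) * norm f"
        by (rule norm_blinfun)
      also have "\<dots> \<le> e / 2 * norm f"
        using d(2)[OF that] by (intro mult_right_mono) (auto simp: dist_norm)
      finally have "norm (blinfun_apply (Mop q) f - blinfun_apply (Mop p) f) \<le> e / 2 * norm f"
        by (simp add: blinfun.diff_left)
      moreover have "norm (blinfun_apply (Mop p) f) \<le>
          norm (blinfun_apply (Mop q) f) + norm (blinfun_apply (Mop q) f - blinfun_apply (Mop p) f)"
        by (metis norm_minus_commute norm_triangle_sub)
      ultimately show "e / 2 * norm f \<le> norm (blinfun_apply (Mop q) f)"
        using e(2)[of f] by simp
    qed (use e in auto)
    with d(1) show ?thesis by (auto simp: sp_def)
  qed
  then have "open (- sp)" unfolding open_dist by blast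
  then show ?thesis by (simp add: closed_def)
qed

lemma sp_fin_subset_sp: "sp_fin n \<subseteq> sp"
proof
  fix p assume "p \<in> sp_fin n"
  then obtain f where f: "f \<noteq> 0" "blinfun_apply (Mop p) f = 0"
    unfolding sp_fin_def mem_Collect_eq bij_Mop_H_cyl_iff by blast
  have "\<not> invertible_op (Mop p)"
  proof
    assume "invertible_op (Mop p)"
    then obtain e where "e > 0" "e * norm f \<le> norm (blinfun_apply (Mop p) f)"
      by (rule invertible_op_imp_bounded_below) blast
    with f show False by (simp add: mult_le_0_iff)
  qed
  then show "p \<in> sp" by (simp add: sp_def)
qed

lemma sp_subset_closure_sp_fin: "sp \<subseteq> closure (\<Union>n. sp_fin n)"
proof (rule ccontr)
  assume "\<not> ?thesis"
  then obtain p where p: "p \<in> sp" "p \<notin> closure (\<Union>n. sp_fin n)" by blast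
  then obtain e where e: "e > 0" "\<And>q n. q \<in> sp_fin n \<Longrightarrow> e \<le> dist q p"
    unfolding closure_approachable by (auto simp: not_less)
  obtain y z l where yz: "p = (y, z, l)" by (cases p)
  have "invertible_op (Mop p)"
  proof (rule invertible_MopI[OF e(1)])
    fix n f assume f: "f \<in> H_cyl n"
    obtain m v where v: "v \<in> H_cyl n" "v \<noteq> 0" "blinfun_apply (Mop p) v = m *\<^sub>R v"
      and m: "\<And>w. w \<in> H_cyl n \<Longrightarrow> \<bar>m\<bar> * norm w \<le> norm (blinfun_apply (Mop p) w)"
      by (rule least_eigenvalue_Mop[where n = n and p = p]) blast
    \<comment> \<open>Raising the third parameter by m subtracts m times the identity, so the
      eigenvector v enters the kernel at a point at distance |m| from p.\<close>
    have "blinfun_apply (Mop (y, z, l + m)) v = 0"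
      using v(3) unfolding yz Mop_apply by (simp add: algebra_simps)
    with v have "(y, z, l + m) \<in> sp_fin n"
      unfolding sp_fin_def mem_Collect_eq bij_Mop_H_cyl_iff by blast
    from e(2)[OF this] have "e \<le> \<bar>m\<bar>" by (simp add: yz dist_Pair_Pair dist_real_def)
    then have "e * norm f \<le> \<bar>m\<bar> * norm f" by (intro mult_right_mono) auto
    also have "\<dots> \<le> norm (blinfun_apply (Mop p) f)" by (rule m[OF f])
    finally show "e * norm f \<le> norm (blinfun_apply (Mop p) f)" .
  qed
  with p(1) show False by (simp add: sp_def)
qed

theorem mainTheorem5:
  shows "closure (Z3 \<union> (\<Union>i. F_preimage i P_plane)) \<subseteq> sp
    \<and> sp = closure (\<Union>n. sp_fin n)
    \<and> closure (\<Union>n. sp_fin n) \<subseteq> closure (Z3 \<union> (\<Union>i. F_preimage i (P_plane \<union> Z1)))"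
proof -
  have sub: "(\<Union>n. sp_fin n) \<subseteq> sp" using sp_fin_subset_sp by blast
  have eq: "sp = closure (\<Union>n. sp_fin n)"
    using sp_subset_closure_sp_fin closure_minimal[OF sub closed_sp] by blast
  have "closure (Z3 \<union> (\<Union>i. F_preimage i P_plane)) \<subseteq> closure (\<Union>n. sp_fin n)"
    using preimages_subset_word_sp unfolding sp_fin_eq_word_sp by (rule closure_mono)
  moreover have "(\<Union>n. sp_fin n) \<subseteq> Z3 \<union> (\<Union>i. F_preimage i (P_plane \<union> Z1))"
    using word_sp_subset_preimages unfolding sp_fin_eq_word_sp by blast
  ultimately show ?thesis using eq closure_mono by blast
qed

end
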